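(* Let $\mathcal X$ be a Banach space of analytic functions on the open unit disc $\mathbb D$ such that: for every $\lambda\in\mathbb D$ the evaluation map $f\in\mathcal X\mapsto f(\lambda)\in\mathbb C$ is continuous; $zf\in\mathcal X$ for every $f\in\mathcal X$; and the set $\mathcal P$ of polynomials is (contained and) dense in $\mathcal X$. Let $\mathcal A$ be a commutative unital Banach algebra of functions on $\mathbb D$ such that: - $\mathcal A\subset\mathfrak M(\mathcal X)$; - for every $\lambda\in\mathbb D$ the evaluation map $f\in\mathcal A\mapsto f(\lambda)\in\mathbb C$ is continuous; - there exist constants $C>0$ and $A\ge 1$ such that for every $\delta>0$ and every $f_1,f_2\in\mathcal A$ satisfying $0<\delta\le |f_1|+|f_2|\le 1$ on $\mathbb D$, there exist $g_1,g_2\in\mathcal A$ with $f_1g_1+f_2g_2\equiv 1$ on $\mathbb D$ and $\|g_1\|_{\mathcal A},\|g_2\|_{\mathcal A}\le C/\delta^{A}$; - the function $\chi_1(z)=z$ belongs to $\mathcal A$; - there exist $C'>0$ and an integer $p\ge 0$ such that $\|\chi_n\|_{\mathcal A}\le C' n^p$ for every $n\ge 1$, where $\chi_n(z)=z^n$. Assume that there exists $\zeta_0\in\mathbb T$ such that the function $z-\zeta_0$ is cyclic for the shift $S$ in $\mathcal X$. Let $f\in\mathcal A\cap A(\mathbb D)$ be an outer function such that $\mathcal Z(f)=\{\zeta_0\}$. Then $f$ is cyclic for $S$ in $\mathcal X$.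
   Context: $\mathbb T$ is the unit circle with normalized Lebesgue measure $m$. $\mathfrak M(\mathcal X)=\{\varphi\in\mathcal X:\varphi f\in\mathcal X \text{ for all } f\in\mathcal X\}$ is the algebra of multipliers of $\mathcal X$. The algebra $\mathcal A$ carries pointwise operations, its unit is the constant function $1$, and it has its own complete norm $\|\cdot\|_{\mathcal A}$. $S:\mathcal X\to\mathcal X$ is the shift operator $(Sf)(z)=zf(z)$. A function $f\in\mathcal X$ is cyclic for $S$ in $\mathcal X$ if $\{pf:p\in\mathcal P\}$ is dense in $\mathcal X$, where $\mathcal P$ is the set of polynomials. $A(\mathbb D)$ is the disc algebra: functions holomorphic on $\mathbb D$ and continuous on $\overline{\mathbb D}$. For $f\in A(\mathbb D)$, $\mathcal Z(f)=\{\zeta\in\mathbb T:f(\zeta)=0\}$. A function $f$ is outer if $f(z)=c\exp\left(\int_{\mathbb T}\frac{\xi+z}{\xi-z}\log\varphi(\xi)\,dm(\xi)\right)$ for $z\in\mathbb D$, with $|c|=1$ and $\varphi\ge 0$ in $L^2(\mathbb T)$ with $\log\varphi\in L^1(\mathbb T)$. *)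

theory Defs
  imports "HOL-Analysis.Analysis" "HOL-Computational_Algebra.Polynomial"
begin

text \<open>
  A function on the open unit disc is represented by a total function that is 0 off the disc,
  so that equality of functions on the disc is equality of HOL functions and the pointwise
  operations need no adjustment.
\<close>

definition on_disc :: "(complex \<Rightarrow> complex) \<Rightarrow> complex \<Rightarrow> complex" where
  "on_disc f = (\<lambda>z. if z \<in> ball 0 1 then f z else 0)"

text \<open>
  The distance is set to 0 off the carrier because \<^locale>\<open>Metric_space\<close> requires nonnegativity
  and symmetry for all arguments, not only for those in the carrier.
\<close>

definition fun_dist ::
    "(complex \<Rightarrow> complex) set \<Rightarrow> ((complex \<Rightarrow> complex) \<Rightarrow> real) \<Rightarrow>
     (complex \<Rightarrow> complex) \<Rightarrow> (complex \<Rightarrow> complex) \<Rightarrow> real" where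
  "fun_dist X N f g = (if f \<in> X \<and> g \<in> X then N (\<lambda>z. f z - g z) else 0)"

locale normed_disc_space =
  fixes X :: "(complex \<Rightarrow> complex) set" and N :: "(complex \<Rightarrow> complex) \<Rightarrow> real"
  assumes vanish: "\<And>f z. f \<in> X \<Longrightarrow> z \<notin> ball 0 1 \<Longrightarrow> f z = 0"
    and zero_mem: "(\<lambda>_. 0) \<in> X"
    and add_mem: "\<And>f g. f \<in> X \<Longrightarrow> g \<in> X \<Longrightarrow> (\<lambda>z. f z + g z) \<in> X"
    and scale_mem: "\<And>c f. f \<in> X \<Longrightarrow> (\<lambda>z. c * f z) \<in> X"
    and norm_eq_0_iff: "\<And>f. f \<in> X \<Longrightarrow> N f = 0 \<longleftrightarrow> f = (\<lambda>_. 0)"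
    and norm_triangle: "\<And>f g. f \<in> X \<Longrightarrow> g \<in> X \<Longrightarrow> N (\<lambda>z. f z + g z) \<le> N f + N g"
    and norm_scale: "\<And>c f. f \<in> X \<Longrightarrow> N (\<lambda>z. c * f z) = cmod c * N f"
begin

lemma uminus_mem: "f \<in> X \<Longrightarrow> (\<lambda>z. - f z) \<in> X"
  using scale_mem[of f "-1"] by simp

lemma diff_mem: "f \<in> X \<Longrightarrow> g \<in> X \<Longrightarrow> (\<lambda>z. f z - g z) \<in> X"
  using add_mem[of f "\<lambda>z. - g z"] uminus_mem by simp

lemma norm_uminus: "f \<in> X \<Longrightarrow> N (\<lambda>z. - f z) = N f"
  using norm_scale[of f "-1"] by simp

lemma norm_nonneg: "f \<in> X \<Longrightarrow> 0 \<le> N f"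
  using norm_triangle[of f "\<lambda>z. - f z"] uminus_mem[of f] norm_uminus[of f]
    norm_eq_0_iff[OF zero_mem] by simp

sublocale Metric_space X "fun_dist X N"
proof
  show "0 \<le> fun_dist X N f g" for f g
    by (simp add: fun_dist_def norm_nonneg diff_mem)
  show "fun_dist X N f g = fun_dist X N g f" for f g
    using norm_uminus[OF diff_mem, of f g] by (simp add: fun_dist_def)
  show "fun_dist X N f g = 0 \<longleftrightarrow> f = g" if "f \<in> X" "g \<in> X" for f g
    using that norm_eq_0_iff[OF diff_mem, of f g] by (simp add: fun_dist_def fun_eq_iff)
  show "fun_dist X N f h \<le> fun_dist X N f g + fun_dist X N g h"
    if "f \<in> X" "g \<in> X" "h \<in> X" for f g h
    using that norm_triangle[OF diff_mem diff_mem, of f g g h] by (simp add: fun_dist_def)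
qed

end

locale banach_disc_space = normed_disc_space +
  assumes complete: mcomplete

text \<open>The unit is not required to have norm 1.\<close>

locale banach_disc_algebra = banach_disc_space +
  assumes one_mem: "on_disc (\<lambda>_. 1) \<in> X"
    and mult_mem: "\<And>f g. f \<in> X \<Longrightarrow> g \<in> X \<Longrightarrow> (\<lambda>z. f z * g z) \<in> X"
    and norm_mult: "\<And>f g. f \<in> X \<Longrightarrow> g \<in> X \<Longrightarrow> N (\<lambda>z. f z * g z) \<le> N f * N g"

abbreviation norm_topology ::
    "(complex \<Rightarrow> complex) set \<Rightarrow> ((complex \<Rightarrow> complex) \<Rightarrow> real) \<Rightarrow> (complex \<Rightarrow> complex) topology" where
  "norm_topology X N \<equiv> Metric_space.mtopology X (fun_dist X N)"

definition continuous_evaluations ::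
    "(complex \<Rightarrow> complex) set \<Rightarrow> ((complex \<Rightarrow> complex) \<Rightarrow> real) \<Rightarrow> bool" where
  "continuous_evaluations X N \<longleftrightarrow>
     (\<forall>w \<in> ball 0 1. continuous_map (norm_topology X N) euclidean (\<lambda>f. f w))"

definition polynomials :: "(complex \<Rightarrow> complex) set" where
  "polynomials = {on_disc (poly p) |p. True}"

definition multipliers :: "(complex \<Rightarrow> complex) set \<Rightarrow> (complex \<Rightarrow> complex) set" where
  "multipliers X = {\<phi> \<in> X. \<forall>f \<in> X. (\<lambda>z. \<phi> z * f z) \<in> X}"

definition cyclic ::
    "(complex \<Rightarrow> complex) set \<Rightarrow> ((complex \<Rightarrow> complex) \<Rightarrow> real) \<Rightarrow> (complex \<Rightarrow> complex) \<Rightarrow> bool" where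
  "cyclic X N f \<longleftrightarrow>
     f \<in> X \<and> norm_topology X N closure_of {(\<lambda>z. q z * f z) |q. q \<in> polynomials} = X"

text \<open>Only the values on the closed unit disc are relevant; the values outside are arbitrary.\<close>

definition disc_algebra :: "(complex \<Rightarrow> complex) set" where
  "disc_algebra = {f. continuous_on (cball 0 1) f \<and> f holomorphic_on ball 0 1}"

definition circle_zeros :: "(complex \<Rightarrow> complex) \<Rightarrow> complex set" where
  "circle_zeros f = {\<zeta> \<in> sphere 0 1. f \<zeta> = 0}"

definition circle_measure :: "complex measure" where
  "circle_measure = distr (uniform_measure lborel {0..<2 * pi}) borel cis"

text \<open>
  Integrability of the logarithm forces the weight to be positive almost everywhere. This has to
  be stated separately since \<^term>\<open>ln (0::real) = 0\<close>.
\<close>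

definition outer :: "(complex \<Rightarrow> complex) \<Rightarrow> bool" where
  "outer f \<longleftrightarrow>
     (\<exists>c \<phi>. cmod c = 1 \<and>
        \<phi> \<in> borel_measurable circle_measure \<and> (\<forall>\<xi> \<in> sphere 0 1. 0 \<le> \<phi> \<xi>) \<and>
        integrable circle_measure (\<lambda>\<xi>. (\<phi> \<xi>)\<^sup>2) \<and>
        (AE \<xi> in circle_measure. 0 < \<phi> \<xi>) \<and>
        integrable circle_measure (\<lambda>\<xi>. ln (\<phi> \<xi>)) \<and>
        (\<forall>z \<in> ball 0 1.
           f z = c * exp (LINT \<xi>|circle_measure. (\<xi> + z) / (\<xi> - z) * of_real (ln (\<phi> \<xi>)))))"

end

theory Submission
  imports Defs "HOL-Complex_Analysis.Complex_Analysis"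
begin

text \<open>
  Let \<open>l\<close> be a bounded functional on \<open>X\<close> that vanishes on all polynomial multiples of \<open>f\<close>, hence on
  \<open>f\<A>\<close>. By the corona hypothesis \<open>z - \<lambda>\<close> is invertible in \<open>\<A>\<close> modulo \<open>f\<close> for each \<open>\<lambda> \<noteq> \<zeta>\<^sub>0\<close>,
  and \<open>l\<close> of the inverse is holomorphic in \<open>\<lambda>\<close>. It grows at most polynomially in \<open>1 / (\<bar>\<lambda>\<bar> - 1)\<close>
  outside the disc, by the bound on the powers of \<open>z\<close>. Inside it is at most \<open>exp (\<epsilon> / (1 - \<bar>\<lambda>\<bar>))\<close>
  near \<open>\<zeta>\<^sub>0\<close> for every \<open>\<epsilon> > 0\<close>, because \<open>log \<bar>f\<bar>\<close> is the Poisson integral of an integrable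
  function. A Phragmen-Lindelof argument shows that \<open>\<zeta>\<^sub>0\<close> is a pole of an order independent of \<open>l\<close>, so
  \<open>l\<close> annihilates \<open>(z - \<zeta>\<^sub>0)\<^sup>n\<close> and all its polynomial multiples. By Hahn-Banach these lie in the
  closure of the polynomial multiples of \<open>f\<close>, and the exponent is lowered to \<open>0\<close> by the cyclicity
  of \<open>z - \<zeta>\<^sub>0\<close>.
\<close>

subsection \<open>Continuity of multiplication operators\<close>

text \<open>Inverses modulo \<open>f\<close> are not unique, and nothing provides a choice of them
  that is analytic in the parameter. All regularity therefore lies in the numbers that
  \<open>l\<close> takes on them: \<open>l\<close> kills multiples of \<open>f\<close>, so these
  numbers do not depend on the choice and obey the resolvent identity. The parameter is changed to
  \<open>v\<close> with \<lambda> = \<zeta> (v + 1) / (v - 1). The exceptional point goes to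
  infinity, the numbers become entire functions of \<open>v\<close>, and a pole turns into
  polynomial growth. The obstacle is that both growth bounds degenerate along the whole circle,
  which is now the imaginary axis. A contour for the maximum principle has to cross that axis; it
  does so only at two corners, where an inserted polynomial vanishes. Each multiplication by
  \<open>1 - u\<close> lowers the polynomial growth by one degree, so one multiplication more than
  the degree leaves an entire function that tends to 0 at infinity, and Liouville's theorem applies.
  Neither the continuity of the inclusion of \<A> in \<open>X\<close> nor that of multiplication by
  \<open>f\<close> is assumed. Both come from a closed graph argument.\<close>

context normed_disc_space
begin

lemma lincomb_mem: "g \<in> X \<Longrightarrow> h \<in> X \<Longrightarrow> (\<lambda>z. a * g z + b * h z) \<in> X"
  by (intro add_mem scale_mem)

lemma norm_diff_commute: "g \<in> X \<Longrightarrow> h \<in> X \<Longrightarrow> N (\<lambda>z. g z - h z) = N (\<lambda>z. h z - g z)"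
  using norm_uminus[OF diff_mem, of g h] by simp

lemma norm_triangle_diff:
  assumes "g \<in> X" "h \<in> X"
  shows "N (\<lambda>z. g z - h z) \<le> N g + N h"
  using norm_triangle[OF assms(1) uminus_mem[OF assms(2)]] norm_uminus[OF assms(2)] by simp

lemma norm_triangle_via:
  assumes "f \<in> X" "g \<in> X" "h \<in> X"
  shows "N (\<lambda>z. f z - h z) \<le> N (\<lambda>z. f z - g z) + N (\<lambda>z. g z - h z)"
  using norm_triangle[OF diff_mem diff_mem, of f g g h] assms by simp

lemma norm_zero: "N (\<lambda>_. 0) = 0"
  using norm_eq_0_iff[OF zero_mem] by simp

lemma in_closure_iff:
  assumes "S \<subseteq> X"
  shows "h \<in> mtopology closure_of S \<longleftrightarrow> h \<in> X \<and> (\<forall>\<epsilon>>0. \<exists>s\<in>S. N (\<lambda>z. h z - s z) < \<epsilon>)"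
  using assms unfolding metric_closure_of by (auto simp: fun_dist_def subset_iff; meson)

lemma evaluation_bound:
  assumes "continuous_evaluations X N" and "w \<in> ball 0 1"
  obtains c where "\<And>h. h \<in> X \<Longrightarrow> cmod (h w) \<le> c * N h"
proof -
  have "continuous_map mtopology euclidean (\<lambda>f. f w)"
    using assms by (auto simp: continuous_evaluations_def)
  then have "openin mtopology {f \<in> X. f w \<in> ball 0 1}"
    using openin_continuous_map_preimage[of mtopology euclidean "\<lambda>f. f w" "ball 0 1"] by simp
  moreover have "(\<lambda>_. 0) \<in> {f \<in> X. f w \<in> ball 0 1}" using zero_mem by simp
  ultimately obtain r where r: "0 < r" "mball (\<lambda>_. 0) r \<subseteq> {f \<in> X. f w \<in> ball 0 1}"
    unfolding openin_mtopology by blast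
  have "cmod (h w) \<le> (2 / r) * N h" if h: "h \<in> X" for h
  proof (cases "N h = 0")
    case True
    then show ?thesis using norm_eq_0_iff[OF h] by simp
  next
    case False
    then have Nh: "0 < N h" using norm_nonneg[OF h] by simp
    define g where "g = (\<lambda>z. of_real (r / (2 * N h)) * h z)"
    have g: "g \<in> X" unfolding g_def by (rule scale_mem[OF h])
    have "N g = r / 2"
      unfolding g_def norm_scale[OF h] using r Nh by (simp add: norm_divide norm_mult)
    then have "N (\<lambda>z. - g z) < r" using r g by (simp add: norm_uminus)
    then have "g \<in> mball (\<lambda>_. 0) r"
      using g zero_mem by (simp add: fun_dist_def)
    then have "cmod (g w) < 1" using r by auto
    then have "r / (2 * N h) * cmod (h w) < 1"
      using r Nh by (simp add: g_def norm_mult norm_divide)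
    then show ?thesis using r Nh by (simp add: field_simps)
  qed
  then show thesis using that by blast
qed

end

text \<open>The rate is explicit because the case \<open>j = 0\<close> is used to bound the norm of
  a limit in terms of \<open>D\<close>.\<close>

lemma (in banach_disc_space) geometric_Cauchy_limit:
  assumes mem: "\<And>j::nat. \<sigma> j \<in> X"
    and step: "\<And>j. N (\<lambda>z. \<sigma> (Suc j) z - \<sigma> j z) \<le> D / 2 ^ j"
  obtains h where "h \<in> X" "\<And>j. N (\<lambda>z. h z - \<sigma> j z) \<le> 2 * D / 2 ^ j"
proof -
  have "0 \<le> D" using order.trans[OF norm_nonneg step[of 0]] mem by (simp add: diff_mem)
  \<comment> \<open>The subtracted term is what makes the geometric estimate inductive in
    \<open>m\<close>.\<close>
  have tail: "N (\<lambda>z. \<sigma> (j + m) z - \<sigma> j z) \<le> 2 * D / 2 ^ j - 2 * D / 2 ^ (j + m)" for j m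
  proof (induction m)
    case 0
    then show ?case by (simp add: norm_zero)
  next
    case (Suc m)
    have "N (\<lambda>z. \<sigma> (j + Suc m) z - \<sigma> j z)
        \<le> N (\<lambda>z. \<sigma> (Suc (j + m)) z - \<sigma> (j + m) z) + N (\<lambda>z. \<sigma> (j + m) z - \<sigma> j z)"
      unfolding add_Suc_right by (intro norm_triangle_via mem)
    also have "\<dots> \<le> D / 2 ^ (j + m) + (2 * D / 2 ^ j - 2 * D / 2 ^ (j + m))"
      by (intro add_mono step Suc.IH)
    also have "\<dots> = 2 * D / 2 ^ j - 2 * D / 2 ^ (j + Suc m)" by simp
    finally show ?case .
  qed
  then have tail': "N (\<lambda>z. \<sigma> m z - \<sigma> j z) \<le> 2 * D / 2 ^ j" if "j \<le> m" for j m
    using that \<open>0 \<le> D\<close> by (auto simp: le_iff_add intro!: order.trans[OF tail])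
  have lim0: "(\<lambda>j. 2 * D / 2 ^ j) \<longlonglongrightarrow> 0" by real_asymp
  have "MCauchy \<sigma>" unfolding MCauchy_def
  proof (intro conjI allI impI)
    fix \<epsilon> :: real assume "0 < \<epsilon>"
    then have "\<forall>\<^sub>F j in sequentially. 2 * D / 2 ^ j < \<epsilon>" using lim0 by (simp add: order_tendstoD)
    then obtain M where M: "\<And>j. M \<le> j \<Longrightarrow> 2 * D / 2 ^ j < \<epsilon>" by (auto simp: eventually_sequentially)
    have "N (\<lambda>z. \<sigma> n z - \<sigma> n' z) < \<epsilon>" if "M \<le> n" "M \<le> n'" for n n'
      using tail'[of n n'] tail'[of n' n] M[OF that(1)] M[OF that(2)]
        norm_diff_commute[OF mem mem, of n n'] by (cases "n \<le> n'") auto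
    then show "\<exists>M. \<forall>n n'. M \<le> n \<longrightarrow> M \<le> n' \<longrightarrow> fun_dist X N (\<sigma> n) (\<sigma> n') < \<epsilon>"
      using mem by (auto simp: fun_dist_def)
  qed (use mem in auto)
  then obtain h where h: "limitin mtopology \<sigma> h sequentially"
    using complete by (auto simp: mcomplete_def)
  then have hX: "h \<in> X" by (simp add: limitin_metric)
  have "N (\<lambda>z. h z - \<sigma> j z) \<le> 2 * D / 2 ^ j" for j
  proof (rule field_le_epsilon)
    fix \<epsilon> :: real assume "0 < \<epsilon>"
    then have "\<forall>\<^sub>F m in sequentially. \<sigma> m \<in> X \<and> fun_dist X N (\<sigma> m) h < \<epsilon>"
      using h unfolding limitin_metric by blast
    then have "\<forall>\<^sub>F m in sequentially. \<sigma> m \<in> X \<and> fun_dist X N (\<sigma> m) h < \<epsilon> \<and> j \<le> m"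
      using eventually_ge_at_top[of j] by eventually_elim auto
    then obtain m where m: "fun_dist X N (\<sigma> m) h < \<epsilon>" "j \<le> m"
      using eventually_happens by fastforce
    have "N (\<lambda>z. h z - \<sigma> j z) \<le> N (\<lambda>z. h z - \<sigma> m z) + N (\<lambda>z. \<sigma> m z - \<sigma> j z)"
      by (intro norm_triangle_via hX mem)
    also have "N (\<lambda>z. h z - \<sigma> m z) \<le> \<epsilon>"
      using m mem hX by (simp add: fun_dist_def norm_diff_commute)
    finally show "N (\<lambda>z. h z - \<sigma> j z) \<le> 2 * D / 2 ^ j + \<epsilon>" using tail'[OF m(2)] by simp
  qed
  with hX show thesis using that by blast
qed

text \<open>A closed graph theorem: continuous point evaluations on both sides force limits to agree
  pointwise. The proof is the classical one, Baire category followed by successive approximation.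
  With the multiplier 1 it also covers inclusions of one space in another.\<close>

lemma multiplication_operator_bounded:
  assumes XN: "banach_disc_space X N" and YM: "banach_disc_space Y M"
    and evX: "continuous_evaluations X N" and evY: "continuous_evaluations Y M"
    and maps: "\<And>g. g \<in> X \<Longrightarrow> (\<lambda>z. \<phi> z * g z) \<in> Y"
  obtains C where "0 \<le> C" "\<And>g. g \<in> X \<Longrightarrow> M (\<lambda>z. \<phi> z * g z) \<le> C * N g"
proof -
  interpret X: banach_disc_space X N by fact
  interpret Y: banach_disc_space Y M by fact
  \<comment> \<open>These sets cover \<open>X\<close>, so by Baire the closure of one of them
    contains a ball.\<close>
  define E where "E = (\<lambda>n::nat. {g \<in> X. M (\<lambda>z. \<phi> z * g z) \<le> real n})"
  have diffY: "(\<lambda>z. \<phi> z * (g z - h z)) = (\<lambda>z. \<phi> z * g z - \<phi> z * h z)" for g h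
    by (simp add: algebra_simps)
  have scaleY: "(\<lambda>z. \<phi> z * (c * g z)) = (\<lambda>z. c * (\<phi> z * g z))" for g c
    by (simp add: algebra_simps)
  obtain n where n: "X.mtopology interior_of (X.mtopology closure_of E n) \<noteq> {}"
  proof (rule ccontr)
    assume "\<not> thesis"
    then have *: "X.mtopology interior_of (X.mtopology closure_of E n) = {}" for n
      using that by blast
    have "X.mtopology interior_of \<Union> (range (\<lambda>n. X.mtopology closure_of E n)) = {}"
      using * by (intro X.metric_Baire_category_alt X.complete) auto
    moreover have "\<Union> (range (\<lambda>n. X.mtopology closure_of E n)) = X"
    proof
      show "\<Union> (range (\<lambda>n. X.mtopology closure_of E n)) \<subseteq> X"
        using closure_of_subset_topspace[of X.mtopology] by auto
      show "X \<subseteq> \<Union> (range (\<lambda>n. X.mtopology closure_of E n))"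
      proof
        fix g assume g: "g \<in> X"
        obtain n where "M (\<lambda>z. \<phi> z * g z) \<le> real n" using real_arch_simple by blast
        then have "g \<in> E n" using g by (simp add: E_def)
        moreover have "E n \<subseteq> X.mtopology closure_of E n"
          by (rule closure_of_subset) (auto simp: E_def)
        ultimately show "g \<in> \<Union> (range (\<lambda>n. X.mtopology closure_of E n))" by auto
      qed
    qed
    ultimately have "X = {}" using interior_of_topspace[of X.mtopology] by simp
    then show False using X.zero_mem by simp
  qed
  then obtain g\<^sub>0 where "g\<^sub>0 \<in> X.mtopology interior_of (X.mtopology closure_of E n)" by blast
  then obtain r where r: "0 < r" "X.mball g\<^sub>0 r \<subseteq> X.mtopology closure_of E n" and g0: "g\<^sub>0 \<in> X"
    using openin_interior_of[of X.mtopology] interior_of_subset[of X.mtopology "X.mtopology closure_of E n"]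
      interior_of_subset_topspace[of X.mtopology]
    unfolding X.openin_mtopology by (metis order.trans subsetD X.topspace_mtopology)
  have near: "\<exists>k\<in>E n. N (\<lambda>z. h z - k z) < \<epsilon>" if "h \<in> X" "N (\<lambda>z. g\<^sub>0 z - h z) < r" "0 < \<epsilon>" for h \<epsilon>
  proof -
    have "h \<in> X.mball g\<^sub>0 r" using that g0 by (simp add: fun_dist_def)
    then have "h \<in> X.mtopology closure_of E n" using r by blast
    moreover have "E n \<subseteq> X" by (auto simp: E_def)
    ultimately show ?thesis using X.in_closure_iff \<open>0 < \<epsilon>\<close> by blast
  qed
  \<comment> \<open>Differences of two elements of \<open>E n\<close> move the ball from
    \<open>g\<^sub>0\<close> to the origin, at the price of a factor 2.\<close>
  have approx1: "\<exists>k\<in>X. M (\<lambda>z. \<phi> z * k z) \<le> 2 * real n \<and> N (\<lambda>z. g z - k z) < \<epsilon>"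
    if g: "g \<in> X" "N g < r" and "0 < \<epsilon>" for g \<epsilon>
  proof -
    have 1: "(\<lambda>z. g\<^sub>0 z + g z) \<in> X" using g0 g by (intro X.add_mem)
    have "N (\<lambda>z. g\<^sub>0 z - (g\<^sub>0 z + g z)) < r" using g X.norm_uminus by simp
    then obtain k1 where k1: "k1 \<in> E n" "N (\<lambda>z. (g\<^sub>0 z + g z) - k1 z) < \<epsilon> / 2"
      using near[OF 1, of "\<epsilon> / 2"] \<open>0 < \<epsilon>\<close> by auto
    have "N (\<lambda>z. g\<^sub>0 z - g\<^sub>0 z) < r" using r by (simp add: X.norm_zero)
    then obtain k0 where k0: "k0 \<in> E n" "N (\<lambda>z. g\<^sub>0 z - k0 z) < \<epsilon> / 2"
      using near[OF g0, of "\<epsilon> / 2"] \<open>0 < \<epsilon>\<close> by auto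
    have kX: "k1 \<in> X" "k0 \<in> X" using k1 k0 by (auto simp: E_def)
    have "M (\<lambda>z. \<phi> z * (k1 z - k0 z)) \<le> M (\<lambda>z. \<phi> z * k1 z) + M (\<lambda>z. \<phi> z * k0 z)"
      unfolding diffY by (intro Y.norm_triangle_diff maps kX)
    also have "\<dots> \<le> 2 * real n" using k1 k0 by (simp add: E_def)
    finally have "M (\<lambda>z. \<phi> z * (k1 z - k0 z)) \<le> 2 * real n" .
    moreover have "N (\<lambda>z. g z - (k1 z - k0 z)) < \<epsilon>"
    proof -
      have "N (\<lambda>z. ((g\<^sub>0 z + g z) - k1 z) - (g\<^sub>0 z - k0 z)) \<le> N (\<lambda>z. (g\<^sub>0 z + g z) - k1 z) + N (\<lambda>z. g\<^sub>0 z - k0 z)"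
        by (intro X.norm_triangle_diff X.diff_mem 1 g0 kX)
      also have "\<dots> < \<epsilon>" using k1 k0 by simp
      also have "(\<lambda>z. ((g\<^sub>0 z + g z) - k1 z) - (g\<^sub>0 z - k0 z)) = (\<lambda>z. g z - (k1 z - k0 z))"
        by (simp add: algebra_simps)
      finally show ?thesis .
    qed
    ultimately show ?thesis using X.diff_mem[OF kX] by (intro bexI[of _ "\<lambda>z. k1 z - k0 z"]) auto
  qed
  \<comment> \<open>Homogeneity turns the bound \<open>2 * real n\<close> on the ball of radius
    \<open>r\<close> into \<open>D * s\<close> on the ball of radius \<open>s\<close>.\<close>
  define D where "D = 2 * real n / r"
  have "0 \<le> D" using r by (simp add: D_def)
  have approx: "\<exists>k\<in>X. M (\<lambda>z. \<phi> z * k z) \<le> D * s \<and> N (\<lambda>z. g z - k z) < \<epsilon>"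
    if g: "g \<in> X" "N g < s" and "0 < \<epsilon>" "0 < s" for g s \<epsilon>
  proof -
    have "N (\<lambda>z. of_real (r / s) * g z) < r"
      unfolding X.norm_scale[OF g(1)] using that r by (simp add: norm_divide field_simps)
    moreover have pos: "0 < \<epsilon> * (r / s)" using that r by simp
    ultimately obtain k where k: "k \<in> X" "M (\<lambda>z. \<phi> z * k z) \<le> 2 * real n"
        "N (\<lambda>z. of_real (r / s) * g z - k z) < \<epsilon> * (r / s)"
      using approx1[OF X.scale_mem[OF g(1)] _ pos] by blast
    define k' where "k' = (\<lambda>z. of_real (s / r) * k z)"
    have "M (\<lambda>z. \<phi> z * k' z) = (s / r) * M (\<lambda>z. \<phi> z * k z)"
      unfolding k'_def scaleY Y.norm_scale[OF maps[OF k(1)]] using that r by (simp add: norm_divide)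
    also have "\<dots> \<le> (s / r) * (2 * real n)" using k that r by (intro mult_left_mono) auto
    also have "\<dots> = D * s" by (simp add: D_def)
    finally have "M (\<lambda>z. \<phi> z * k' z) \<le> D * s" .
    moreover have "N (\<lambda>z. g z - k' z) < \<epsilon>"
    proof -
      have "(\<lambda>z. g z - k' z) = (\<lambda>z. of_real (s / r) * (of_real (r / s) * g z - k z))"
        using that r by (simp add: k'_def algebra_simps)
      then have "N (\<lambda>z. g z - k' z) = (s / r) * N (\<lambda>z. of_real (r / s) * g z - k z)"
        using X.norm_scale[OF X.diff_mem[OF X.scale_mem[OF g(1)] k(1)], of "of_real (s / r)" "of_real (r / s)"] that r
        by (simp add: norm_divide)
      also have "\<dots> < (s / r) * (\<epsilon> * (r / s))" using k that r by (intro mult_strict_left_mono) auto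
      also have "\<dots> = \<epsilon>" using that r by simp
      finally show ?thesis .
    qed
    moreover have "k' \<in> X" unfolding k'_def by (rule X.scale_mem[OF k(1)])
    ultimately show ?thesis by auto
  qed
  \<comment> \<open>\<open>\<rho> j\<close> is what remains of \<open>g\<close> after
    \<open>j\<close> approximations, and the images of the removed pieces form a geometric series in
    \<open>Y\<close>. The clause \<open>j = 0 \<longrightarrow> x = g\<close> only fixes the
    starting point of the dependent choice.\<close>
  have unit: "M (\<lambda>z. \<phi> z * g z) \<le> 2 * D" if g: "g \<in> X" "N g < 1" for g
  proof -
    have "\<exists>\<rho>. \<forall>j. ((\<rho> j \<in> X \<and> N (\<rho> j) < 1 / 2 ^ j) \<and> (j = 0 \<longrightarrow> \<rho> j = g)) \<and>
        (M (\<lambda>z. \<phi> z * (\<rho> j z - \<rho> (Suc j) z)) \<le> D / 2 ^ j)"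
    proof (rule dependent_nat_choice[where P = "\<lambda>j x. (x \<in> X \<and> N x < 1 / 2 ^ j) \<and> (j = 0 \<longrightarrow> x = g)"
        and Q = "\<lambda>j x y. M (\<lambda>z. \<phi> z * (x z - y z)) \<le> D / 2 ^ j"])
      show "\<exists>x. (x \<in> X \<and> N x < 1 / 2 ^ 0) \<and> (0 = 0 \<longrightarrow> x = g)" using g by auto
      fix x and j :: nat
      assume "(x \<in> X \<and> N x < 1 / 2 ^ j) \<and> (j = 0 \<longrightarrow> x = g)"
      then obtain k where k: "k \<in> X" "M (\<lambda>z. \<phi> z * k z) \<le> D * (1 / 2 ^ j)"
          "N (\<lambda>z. x z - k z) < 1 / 2 ^ Suc j" and x: "x \<in> X"
        using approx[of x "1 / 2 ^ j" "1 / 2 ^ Suc j"] by auto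
      then show "\<exists>y. ((y \<in> X \<and> N y < 1 / 2 ^ Suc j) \<and> (Suc j = 0 \<longrightarrow> y = g)) \<and>
          M (\<lambda>z. \<phi> z * (x z - y z)) \<le> D / 2 ^ j"
        by (intro exI[of _ "\<lambda>z. x z - k z"]) (auto simp: X.diff_mem)
    qed
    then obtain \<rho> where \<rho>: "\<And>j. \<rho> j \<in> X" "\<And>j. N (\<rho> j) < 1 / 2 ^ j" "\<rho> 0 = g"
      "\<And>j. M (\<lambda>z. \<phi> z * (\<rho> j z - \<rho> (Suc j) z)) \<le> D / 2 ^ j" by blast
    define \<sigma> where "\<sigma> = (\<lambda>j z. \<phi> z * (g z - \<rho> j z))"
    have \<sigma>Y: "\<sigma> j \<in> Y" for j unfolding \<sigma>_def using g \<rho> by (intro maps X.diff_mem)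
    have "M (\<lambda>z. \<sigma> (Suc j) z - \<sigma> j z) \<le> D / 2 ^ j" for j
      using \<rho>(4)[of j] by (simp add: \<sigma>_def algebra_simps)
    then obtain h where h: "h \<in> Y" "\<And>j. M (\<lambda>z. h z - \<sigma> j z) \<le> 2 * D / 2 ^ j"
      using Y.geometric_Cauchy_limit[of \<sigma> D] \<sigma>Y by blast
    \<comment> \<open>The abstract limit \<open>h\<close> is identified by point evaluations: at
      each \<open>z\<close> both errors tend to 0.\<close>
    have "h z = \<phi> z * g z" for z
    proof (cases "z \<in> ball 0 1")
      case False
      then show ?thesis using Y.vanish[OF h(1)] X.vanish[OF g(1)] by simp
    next
      case True
      obtain c where c: "\<And>k. k \<in> X \<Longrightarrow> cmod (k z) \<le> c * N k" using X.evaluation_bound[OF evX True] by blast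
      obtain c' where c': "\<And>k. k \<in> Y \<Longrightarrow> cmod (k z) \<le> c' * M k" using Y.evaluation_bound[OF evY True] by blast
      have "cmod (h z - \<phi> z * g z) \<le> \<bar>c'\<bar> * (2 * D / 2 ^ j) + cmod (\<phi> z) * (\<bar>c\<bar> * (1 / 2 ^ j))" for j
      proof -
        have "cmod (h z - \<sigma> j z) \<le> c' * M (\<lambda>z. h z - \<sigma> j z)" by (intro c' Y.diff_mem h \<sigma>Y)
        also have "\<dots> \<le> \<bar>c'\<bar> * (2 * D / 2 ^ j)"
          using h(2)[of j] Y.norm_nonneg[OF Y.diff_mem[OF h(1) \<sigma>Y[of j]]] by (intro mult_mono) auto
        finally have 1: "cmod (h z - \<sigma> j z) \<le> \<bar>c'\<bar> * (2 * D / 2 ^ j)" .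
        have "cmod (\<rho> j z) \<le> c * N (\<rho> j)" by (intro c \<rho>)
        also have "\<dots> \<le> \<bar>c\<bar> * (1 / 2 ^ j)"
          using \<rho>(2)[of j] X.norm_nonneg[OF \<rho>(1)[of j]] by (intro mult_mono) auto
        finally have 2: "cmod (\<phi> z * \<rho> j z) \<le> cmod (\<phi> z) * (\<bar>c\<bar> * (1 / 2 ^ j))"
          unfolding norm_mult by (intro mult_left_mono) auto
        have "h z - \<phi> z * g z = (h z - \<sigma> j z) - \<phi> z * \<rho> j z" by (simp add: \<sigma>_def algebra_simps)
        also have "cmod \<dots> \<le> cmod (h z - \<sigma> j z) + cmod (\<phi> z * \<rho> j z)" by (rule norm_triangle_ineq4)
        finally show ?thesis using 1 2 by linarith
      qed
      moreover have "(\<lambda>j. \<bar>c'\<bar> * (2 * D / 2 ^ j) + cmod (\<phi> z) * (\<bar>c\<bar> * (1 / 2 ^ j))) \<longlonglongrightarrow> 0"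
        by real_asymp
      ultimately have "cmod (h z - \<phi> z * g z) \<le> 0" by (intro LIMSEQ_le_const) auto
      then show ?thesis by simp
    qed
    then have "(\<lambda>z. \<phi> z * g z) = (\<lambda>z. h z - \<sigma> 0 z)" using \<rho>(3) by (auto simp: \<sigma>_def)
    then show ?thesis using h(2)[of 0] by simp
  qed
  show thesis
  proof (rule that[of "4 * D"])
    fix g assume g: "g \<in> X"
    show "M (\<lambda>z. \<phi> z * g z) \<le> 4 * D * N g"
    proof (cases "N g = 0")
      case True
      then have "g = (\<lambda>_. 0)" using X.norm_eq_0_iff[OF g] by simp
      then show ?thesis using True by (simp add: Y.norm_zero)
    next
      case False
      then have Ng: "0 < N g" using X.norm_nonneg[OF g] by simp
      define c where "c = complex_of_real (1 / (2 * N g))"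
      have nc: "cmod c = 1 / (2 * N g)" using Ng by (simp add: c_def norm_divide norm_mult)
      have "N (\<lambda>z. c * g z) < 1" unfolding X.norm_scale[OF g] nc using Ng by simp
      then have "M (\<lambda>z. \<phi> z * (c * g z)) \<le> 2 * D" by (intro unit X.scale_mem g)
      then have "M (\<lambda>z. \<phi> z * g z) / (2 * N g) \<le> 2 * D"
        unfolding scaleY Y.norm_scale[OF maps[OF g]] nc by simp
      then show ?thesis using Ng by (simp add: pos_divide_le_eq mult_ac)
    qed
  qed (use \<open>0 \<le> D\<close> in simp)
qed

subsection \<open>The Hahn-Banach theorem\<close>

text \<open>Homogeneity is only an inequality, since applying it to \<open>1 / t\<close> as well
  gives equality. This halves the work for the functionals defined below as infima.\<close>

definition sublinear_on :: "(complex \<Rightarrow> complex) set \<Rightarrow> ((complex \<Rightarrow> complex) \<Rightarrow> real) \<Rightarrow> bool" where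
  "sublinear_on X p \<longleftrightarrow>
     (\<forall>g\<in>X. \<forall>h\<in>X. p (\<lambda>z. g z + h z) \<le> p g + p h) \<and>
     (\<forall>g\<in>X. \<forall>t>0. p (\<lambda>z. of_real t * g z) \<le> t * p g)"

context normed_disc_space
begin

lemma sublinear_onD:
  assumes "sublinear_on X p"
  shows "g \<in> X \<Longrightarrow> h \<in> X \<Longrightarrow> p (\<lambda>z. g z + h z) \<le> p g + p h"
    and "g \<in> X \<Longrightarrow> 0 < t \<Longrightarrow> p (\<lambda>z. of_real t * g z) = t * p g"
    and "p (\<lambda>_. 0) = 0"
proof -
  show "g \<in> X \<Longrightarrow> h \<in> X \<Longrightarrow> p (\<lambda>z. g z + h z) \<le> p g + p h"
    using assms by (simp add: sublinear_on_def)
  show hom: "p (\<lambda>z. of_real t * g z) = t * p g" if "g \<in> X" "0 < t" for g t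
  proof (rule antisym)
    show "p (\<lambda>z. of_real t * g z) \<le> t * p g"
      using assms that by (simp add: sublinear_on_def)
    have "p (\<lambda>z. of_real (1 / t) * (of_real t * g z)) \<le> 1 / t * p (\<lambda>z. of_real t * g z)"
      using assms that scale_mem[OF that(1)] unfolding sublinear_on_def
      by (metis divide_pos_pos zero_less_one)
    moreover have "(\<lambda>z. of_real (1 / t) * (of_real t * g z)) = g" using that by auto
    ultimately show "t * p g \<le> p (\<lambda>z. of_real t * g z)" using that by (simp add: field_simps)
  qed
  show "p (\<lambda>_. 0) = 0" using hom[OF zero_mem, of 2] by simp
qed

lemma sublinear_lower_bound:
  assumes "sublinear_on X p" "g \<in> X"
  shows "- p (\<lambda>z. - g z) \<le> p g"
  using sublinear_onD(1)[OF assms(1) assms(2) uminus_mem[OF assms(2)]] sublinear_onD(3)[OF assms(1)] by simp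

text \<open>The functional is the infimum over \<open>t \<ge> 0\<close> of
  \<open>p (g + t x) - t * p x\<close>. Taking \<open>t = 0\<close> shows that it lies below
  \<open>p\<close>, and \<open>t = 1\<close> gives the value at \<open>- x\<close>. The value 0 off
  \<open>X\<close> makes the pointwise order of total functions agree with the order on
  \<open>X\<close>, as Zorn's lemma needs later.\<close>

lemma sublinear_reduction:
  assumes p: "sublinear_on X p" and x: "x \<in> X"
  obtains q where "sublinear_on X q" "\<And>g. g \<in> X \<Longrightarrow> q g \<le> p g" "q (\<lambda>z. - x z) \<le> - p x"
    "\<And>g. g \<notin> X \<Longrightarrow> q g = 0"
proof -
  define v where "v = (\<lambda>g t. p (\<lambda>z. g z + of_real t * x z) - t * p x)"
  define q where "q = (\<lambda>g. if g \<in> X then Inf (v g ` {0..}) else 0)"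
  have tx: "p (\<lambda>z. of_real t * x z) = t * p x" if "0 \<le> t" for t
    using that sublinear_onD(2,3)[OF p] x by (cases "t = 0") auto
  have low: "- p (\<lambda>z. - g z) \<le> v g t" if "g \<in> X" "0 \<le> t" for g t
  proof -
    have "p (\<lambda>z. (g z + of_real t * x z) + - g z) \<le> p (\<lambda>z. g z + of_real t * x z) + p (\<lambda>z. - g z)"
      using that x by (intro sublinear_onD(1)[OF p] add_mem scale_mem uminus_mem)
    then show ?thesis using tx[OF that(2)] by (simp add: v_def)
  qed
  have bdd: "bdd_below (v g ` {0..})" if "g \<in> X" for g
    using low[OF that] by (auto simp: bdd_below_def)
  have q_le: "q g \<le> v g t" if "g \<in> X" "0 \<le> t" for g t
    using that bdd by (auto simp: q_def intro!: cInf_lower)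
  have q_ge: "c \<le> q g" if "g \<in> X" "\<And>t. 0 \<le> t \<Longrightarrow> c \<le> v g t" for g c
    using that by (auto simp: q_def intro!: cInf_greatest)
  show thesis
  proof (rule that)
    show "sublinear_on X q" unfolding sublinear_on_def
    proof (intro conjI ballI allI impI)
      fix g h assume g: "g \<in> X" and h: "h \<in> X"
      have *: "q (\<lambda>z. g z + h z) \<le> v g s + v h t" if "0 \<le> s" "0 \<le> t" for s t
      proof -
        have "q (\<lambda>z. g z + h z) \<le> v (\<lambda>z. g z + h z) (s + t)"
          using that g h by (intro q_le add_mem) auto
        also have "\<dots> \<le> v g s + v h t"
          using sublinear_onD(1)[OF p add_mem[OF g scale_mem[OF x]] add_mem[OF h scale_mem[OF x]], of "of_real s" "of_real t"]
          by (simp add: v_def algebra_simps)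
        finally show ?thesis .
      qed
      have "q (\<lambda>z. g z + h z) - v h t \<le> q g" if "0 \<le> t" for t
        using *[OF _ that] by (intro q_ge g) (simp add: algebra_simps)
      then have "q (\<lambda>z. g z + h z) - q g \<le> q h" by (intro q_ge h) (simp add: algebra_simps)
      then show "q (\<lambda>z. g z + h z) \<le> q g + q h" by simp
    next
      fix g and c :: real assume g: "g \<in> X" and c: "0 < c"
      have "q (\<lambda>z. of_real c * g z) \<le> c * v g t" if "0 \<le> t" for t
      proof -
        have "q (\<lambda>z. of_real c * g z) \<le> v (\<lambda>z. of_real c * g z) (c * t)"
          using that c g by (intro q_le scale_mem) auto
        also have "\<dots> = c * v g t"
          using sublinear_onD(2)[OF p add_mem[OF g scale_mem[OF x]] c, of "of_real t"]
          by (simp add: v_def algebra_simps)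
        finally show ?thesis .
      qed
      then have "q (\<lambda>z. of_real c * g z) / c \<le> q g"
        using c by (intro q_ge g) (simp add: pos_divide_le_eq mult.commute)
      then show "q (\<lambda>z. of_real c * g z) \<le> c * q g" using c by (simp add: pos_divide_le_eq mult.commute)
    qed
    show "q g \<le> p g" if "g \<in> X" for g using q_le[OF that, of 0] by (simp add: v_def)
    show "q (\<lambda>z. - x z) \<le> - p x"
      using q_le[OF uminus_mem[OF x], of 1] sublinear_onD(3)[OF p] by (simp add: v_def)
  qed (simp add: q_def)
qed

text \<open>By the previous reduction, a minimal sublinear functional is odd, hence linear.\<close>

lemma Hahn_Banach_real:
  assumes p: "sublinear_on X p" and x: "x \<in> X"
  obtains m where "\<And>g h. g \<in> X \<Longrightarrow> h \<in> X \<Longrightarrow> m (\<lambda>z. g z + h z) = m g + m h"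
    "\<And>g t. g \<in> X \<Longrightarrow> m (\<lambda>z. of_real t * g z) = t * m g"
    "\<And>g. g \<in> X \<Longrightarrow> m g \<le> p g" "p x \<le> m x"
proof -
  \<comment> \<open>Lowering \<open>p\<close> at \<open>- x\<close> beforehand secures the last
    claim: any odd \<open>m\<close> below \<open>p0\<close> has
    \<open>- m x \<le> p0 (- x) \<le> - p x\<close>.\<close>
  obtain p0 where p0: "sublinear_on X p0" "\<And>g. g \<in> X \<Longrightarrow> p0 g \<le> p g" "p0 (\<lambda>z. - x z) \<le> - p x"
    "\<And>g. g \<notin> X \<Longrightarrow> p0 g = 0"
    using sublinear_reduction[OF p x] by blast
  define A where "A = {q. sublinear_on X q \<and> (\<forall>g\<in>X. q g \<le> p0 g) \<and> (\<forall>g. g \<notin> X \<longrightarrow> q g = 0)}"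
  have "\<exists>m\<in>A. \<forall>a\<in>A. a \<le> m \<longrightarrow> a = m"
  proof (rule predicate_Zorn)
    show "partial_order_on A (relation_of (\<lambda>q r. r \<le> q) A)"
      by (rule partial_order_on_relation_ofI) auto
    fix C assume "C \<in> Chains (relation_of (\<lambda>q r. r \<le> q) A)"
    then have CA: "C \<subseteq> A" and chain: "\<And>q r. q \<in> C \<Longrightarrow> r \<in> C \<Longrightarrow> q \<le> r \<or> r \<le> q"
      by (auto simp: Chains_def relation_of_def)
    show "\<exists>u\<in>A. \<forall>a\<in>C. u \<le> a"
    proof (cases "C = {}")
      case True
      then show ?thesis using p0 by (auto simp: A_def)
    next
      case False
      \<comment> \<open>The lower bound of a chain is its pointwise infimum, finite because every
        member lies above \<open>- p0 (- g)\<close> at \<open>g\<close>.\<close>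
      define u where "u = (\<lambda>g. if g \<in> X then Inf ((\<lambda>q. q g) ` C) else 0)"
      have bdd: "bdd_below ((\<lambda>q. q g) ` C)" if g: "g \<in> X" for g
        unfolding bdd_below_def
      proof (intro exI[of _ "- p0 (\<lambda>z. - g z)"] ballI)
        fix y assume "y \<in> (\<lambda>q. q g) ` C"
        then obtain q where q: "q \<in> A" "y = q g" using CA by auto
        then have "- q (\<lambda>z. - g z) \<le> q g" "q (\<lambda>z. - g z) \<le> p0 (\<lambda>z. - g z)"
          using sublinear_lower_bound g uminus_mem by (auto simp: A_def)
        then show "- p0 (\<lambda>z. - g z) \<le> y" using q by simp
      qed
      have u_le: "u g \<le> q g" if "g \<in> X" "q \<in> C" for g q
        using that bdd by (auto simp: u_def intro!: cInf_lower)
      have u_ge: "c \<le> u g" if "g \<in> X" "\<And>q. q \<in> C \<Longrightarrow> c \<le> q g" for g c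
        using that False by (auto simp: u_def intro!: cInf_greatest)
      have sub: "sublinear_on X u" unfolding sublinear_on_def
      proof (intro conjI ballI allI impI)
        fix g h assume g: "g \<in> X" and h: "h \<in> X"
        \<comment> \<open>Two members of the chain may realise the infima at \<open>g\<close> and at
          \<open>h\<close>; the smaller of them serves for both.\<close>
        have *: "u (\<lambda>z. g z + h z) \<le> q g + r h" if qr: "q \<in> C" "r \<in> C" for q r
        proof -
          obtain s where s: "s \<in> C" "s \<le> q" "s \<le> r" using chain[OF qr] qr by blast
          have "u (\<lambda>z. g z + h z) \<le> s (\<lambda>z. g z + h z)" using s g h by (intro u_le add_mem)
          also have "\<dots> \<le> s g + s h"
            using s CA g h by (intro sublinear_onD(1)) (auto simp: A_def)
          also have "\<dots> \<le> q g + r h" using s by (intro add_mono) (auto simp: le_fun_def)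
          finally show ?thesis .
        qed
        have "u (\<lambda>z. g z + h z) - r h \<le> u g" if "r \<in> C" for r
          using *[OF _ that] by (intro u_ge g) (simp add: algebra_simps)
        then have "u (\<lambda>z. g z + h z) - u g \<le> u h" by (intro u_ge h) (simp add: algebra_simps)
        then show "u (\<lambda>z. g z + h z) \<le> u g + u h" by simp
      next
        fix g and c :: real assume g: "g \<in> X" and c: "0 < c"
        have "u (\<lambda>z. of_real c * g z) \<le> c * q g" if "q \<in> C" for q
          using u_le[OF scale_mem[OF g] that, of "of_real c"] sublinear_onD(2)[OF _ g c, of q] that CA
          by (auto simp: A_def)
        then have "u (\<lambda>z. of_real c * g z) / c \<le> u g"
          using c by (intro u_ge g) (simp add: pos_divide_le_eq mult.commute)
        then show "u (\<lambda>z. of_real c * g z) \<le> c * u g" using c by (simp add: pos_divide_le_eq mult.commute)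
      qed
      obtain q where "q \<in> C" using False by blast
      then have "u g \<le> p0 g" if "g \<in> X" for g
        using u_le[OF that] CA that by (fastforce simp: A_def)
      then have "u \<in> A" using sub by (auto simp: A_def u_def)
      moreover have "u \<le> a" if "a \<in> C" for a
      proof (rule le_funI)
        show "u g \<le> a g" for g using u_le[of g a] that CA by (cases "g \<in> X") (auto simp: A_def u_def)
      qed
      ultimately show ?thesis by blast
    qed
  qed
  then obtain m where m: "sublinear_on X m" "\<And>g. g \<in> X \<Longrightarrow> m g \<le> p0 g" "\<And>g. g \<notin> X \<Longrightarrow> m g = 0"
    and min: "\<And>a. a \<in> A \<Longrightarrow> a \<le> m \<Longrightarrow> a = m" by (auto simp: A_def)
  have odd: "m (\<lambda>z. - g z) = - m g" if g: "g \<in> X" for g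
  proof -
    obtain q where q: "sublinear_on X q" "\<And>h. h \<in> X \<Longrightarrow> q h \<le> m h" "q (\<lambda>z. - g z) \<le> - m g"
      "\<And>h. h \<notin> X \<Longrightarrow> q h = 0"
      using sublinear_reduction[OF m(1) g] by blast
    have "q \<in> A" using q m by (auto simp: A_def intro: order.trans)
    moreover have "q \<le> m"
    proof (rule le_funI)
      show "q h \<le> m h" for h using q m by (cases "h \<in> X") auto
    qed
    ultimately have "q = m" by (rule min)
    then show ?thesis using q(3) sublinear_lower_bound[OF m(1) g] by simp
  qed
  show thesis
  proof (rule that)
    show "m (\<lambda>z. g z + h z) = m g + m h" if "g \<in> X" "h \<in> X" for g h
      using sublinear_onD(1)[OF m(1) that] odd[OF that(2)]
        sublinear_onD(1)[OF m(1) add_mem[OF that] uminus_mem[OF that(2)]] by simp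
    show "m (\<lambda>z. of_real t * g z) = t * m g" if g: "g \<in> X" for g t
    proof (cases t "0::real" rule: linorder_cases)
      case less
      then have "m (\<lambda>z. of_real (- t) * g z) = - t * m g" by (intro sublinear_onD(2)[OF m(1) g]) simp
      then show ?thesis using odd[OF scale_mem[OF g, of "of_real t"]] by simp
    qed (use sublinear_onD(2,3)[OF m(1)] g in auto)
    show "m g \<le> p g" if "g \<in> X" for g using m p0 that by (meson order.trans)
    show "p x \<le> m x" using m(2)[OF uminus_mem[OF x]] p0(3) odd[OF x] by simp
  qed
qed

text \<open>Hahn-Banach is applied to the distance \<open>p\<close> from \<open>S\<close>.
  Domination by \<open>p\<close> makes the functional vanish on \<open>S\<close>, while its real
  part at \<open>x\<close> is at least the distance of \<open>x\<close>.\<close>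

lemma separating_functional:
  assumes S: "S \<subseteq> X" "\<And>g h a b. g \<in> S \<Longrightarrow> h \<in> S \<Longrightarrow> (\<lambda>z. a * g z + b * h z) \<in> S" "(\<lambda>_. 0) \<in> S"
    and x: "x \<in> X" and far: "0 < \<epsilon>" "\<And>s. s \<in> S \<Longrightarrow> \<epsilon> \<le> N (\<lambda>z. x z - s z)"
  obtains l :: "(complex \<Rightarrow> complex) \<Rightarrow> complex"
    where "\<And>g h a b. g \<in> X \<Longrightarrow> h \<in> X \<Longrightarrow> l (\<lambda>z. a * g z + b * h z) = a * l g + b * l h"
      "\<And>g. g \<in> X \<Longrightarrow> cmod (l g) \<le> N g" "\<And>s. s \<in> S \<Longrightarrow> l s = 0" "l x \<noteq> 0"
proof -
  define p where "p = (\<lambda>g. Inf ((\<lambda>s. N (\<lambda>z. g z - s z)) ` S))"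
  have mem: "(\<lambda>z. g z - s z) \<in> X" if "g \<in> X" "s \<in> S" for g s using that S by (intro diff_mem) auto
  have p_le: "p g \<le> N (\<lambda>z. g z - s z)" if "g \<in> X" "s \<in> S" for g s
    unfolding p_def using that mem norm_nonneg
    by (intro cInf_lower) (auto simp: bdd_below_def intro!: exI[of _ 0])
  have p_ge: "c \<le> p g" if "g \<in> X" "\<And>s. s \<in> S \<Longrightarrow> c \<le> N (\<lambda>z. g z - s z)" for g c
    unfolding p_def using that S by (intro cInf_greatest) auto
  have p_scale: "p (\<lambda>z. c * g z) \<le> cmod c * p g" if g: "g \<in> X" and c: "c \<noteq> 0" for g c
  proof -
    have "p (\<lambda>z. c * g z) \<le> cmod c * N (\<lambda>z. g z - s z)" if s: "s \<in> S" for s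
    proof -
      have "(\<lambda>z. c * s z) \<in> S" using S(2)[OF s s, of c 0] by simp
      then have "p (\<lambda>z. c * g z) \<le> N (\<lambda>z. c * g z - c * s z)" by (intro p_le scale_mem g)
      also have "\<dots> = cmod c * N (\<lambda>z. g z - s z)"
        using norm_scale[OF mem[OF g s], of c] by (simp add: algebra_simps)
      finally show ?thesis .
    qed
    then have "p (\<lambda>z. c * g z) / cmod c \<le> p g"
      using c by (intro p_ge g) (simp add: pos_divide_le_eq mult.commute)
    then show ?thesis using c by (simp add: pos_divide_le_eq mult.commute)
  qed
  have "sublinear_on X p" unfolding sublinear_on_def
  proof (intro conjI ballI allI impI)
    fix g h assume g: "g \<in> X" and h: "h \<in> X"
    have *: "p (\<lambda>z. g z + h z) \<le> N (\<lambda>z. g z - s z) + N (\<lambda>z. h z - t z)" if "s \<in> S" "t \<in> S" for s t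
    proof -
      have "(\<lambda>z. s z + t z) \<in> S" using S(2)[OF that, of 1 1] by simp
      then have "p (\<lambda>z. g z + h z) \<le> N (\<lambda>z. g z + h z - (s z + t z))" by (intro p_le add_mem g h)
      also have "(\<lambda>z. g z + h z - (s z + t z)) = (\<lambda>z. (g z - s z) + (h z - t z))"
        by (simp add: algebra_simps)
      also have "N \<dots> \<le> N (\<lambda>z. g z - s z) + N (\<lambda>z. h z - t z)"
        using that g h by (intro norm_triangle mem)
      finally show ?thesis .
    qed
    have "p (\<lambda>z. g z + h z) - N (\<lambda>z. h z - t z) \<le> p g" if "t \<in> S" for t
      using *[OF _ that] by (intro p_ge g) (simp add: algebra_simps)
    then have "p (\<lambda>z. g z + h z) - p g \<le> p h" by (intro p_ge h) (simp add: algebra_simps)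
    then show "p (\<lambda>z. g z + h z) \<le> p g + p h" by simp
  next
    fix g and t :: real assume "g \<in> X" "0 < t"
    then show "p (\<lambda>z. of_real t * g z) \<le> t * p g" using p_scale[of g "of_real t"] by simp
  qed
  then obtain m where m: "\<And>g h. g \<in> X \<Longrightarrow> h \<in> X \<Longrightarrow> m (\<lambda>z. g z + h z) = m g + m h"
    "\<And>g t. g \<in> X \<Longrightarrow> m (\<lambda>z. of_real t * g z) = t * m g"
    "\<And>g. g \<in> X \<Longrightarrow> m g \<le> p g" "p x \<le> m x"
    using Hahn_Banach_real[OF _ x] by blast
  \<comment> \<open>The complex functional whose real part is \<open>m\<close>.\<close>
  define l where "l = (\<lambda>g. Complex (m g) (- m (\<lambda>z. \<i> * g z)))"
  have l_add: "l (\<lambda>z. g z + h z) = l g + l h" if "g \<in> X" "h \<in> X" for g h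
    using m(1)[OF that] m(1)[OF scale_mem[OF that(1)] scale_mem[OF that(2)], of \<i> \<i>]
    by (simp add: l_def complex_eq_iff distrib_left)
  have l_real: "l (\<lambda>z. of_real t * g z) = of_real t * l g" if "g \<in> X" for g t
    using m(2)[OF that, of t] m(2)[OF scale_mem[OF that, of \<i>], of t]
    by (simp add: l_def complex_eq_iff mult.left_commute)
  have l_i: "l (\<lambda>z. \<i> * g z) = \<i> * l g" if "g \<in> X" for g
  proof -
    have "m (\<lambda>z. \<i> * (\<i> * g z)) = - m g"
      using m(2)[OF that, of "-1"] by (simp add: mult.assoc[symmetric])
    then show ?thesis by (simp add: l_def complex_eq_iff)
  qed
  have l_scale: "l (\<lambda>z. c * g z) = c * l g" if g: "g \<in> X" for g c
  proof -
    have eq: "(\<lambda>z. c * g z) = (\<lambda>z. of_real (Re c) * g z + of_real (Im c) * (\<i> * g z))"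
      by (subst complex_eq[of c]) (simp add: algebra_simps)
    have "l (\<lambda>z. c * g z) = of_real (Re c) * l g + of_real (Im c) * (\<i> * l g)"
      unfolding eq using g by (simp add: l_add l_real l_i scale_mem)
    also have "\<dots> = (of_real (Re c) + \<i> * of_real (Im c)) * l g" by (simp add: algebra_simps)
    finally show ?thesis by (simp flip: complex_eq)
  qed
  have bound: "cmod (l g) \<le> p g" if g: "g \<in> X" for g
  proof (cases "l g = 0")
    case True
    have "0 \<le> p g" using mem[OF g] by (intro p_ge g norm_nonneg)
    then show ?thesis using True by simp
  next
    case False
    \<comment> \<open>A rotation that makes the value real, so that the bound on the real part
      bounds the modulus.\<close>
    define c where "c = cnj (l g) / cmod (l g)"
    have c: "cmod c = 1" "c \<noteq> 0" using False by (auto simp: c_def norm_divide)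
    have "c * l g = cmod (l g)"
      using False complex_norm_square[of "l g"] by (simp add: c_def field_simps power2_eq_square)
    then have "cmod (l g) = Re (l (\<lambda>z. c * g z))" by (simp add: l_scale[OF g])
    also have "\<dots> \<le> p (\<lambda>z. c * g z)" using m(3)[OF scale_mem[OF g]] by (simp add: l_def)
    also have "\<dots> \<le> p g" using p_scale[OF g c(2)] c by simp
    finally show ?thesis .
  qed
  show thesis
  proof (rule that)
    show "l (\<lambda>z. a * g z + b * h z) = a * l g + b * l h" if "g \<in> X" "h \<in> X" for g h a b
      using that by (simp add: l_add l_scale scale_mem)
    show "cmod (l g) \<le> N g" if "g \<in> X" for g
      using bound[OF that] p_le[OF that S(3)] by simp
    show "l s = 0" if "s \<in> S" for s
    proof -
      have "s \<in> X" using that S(1) by blast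
      then have "cmod (l s) \<le> N (\<lambda>_. 0)" using bound p_le[OF _ that] by fastforce
      then show ?thesis using norm_eq_0_iff[OF zero_mem] by simp
    qed
    have "\<epsilon> \<le> p x" using far by (intro p_ge x)
    then have "0 < m x" using m(4) far by simp
    then show "l x \<noteq> 0" by (simp add: l_def complex_eq_iff)
  qed
qed

end

subsection \<open>A Phragmen-Lindelof principle\<close>

lemma two_pole_partial_fractions:
  assumes "v\<^sup>2 + (of_real R)\<^sup>2 \<noteq> (0::complex)"
  shows "2 * v / (v\<^sup>2 + (of_real R)\<^sup>2) = 1 / (v - \<i> * of_real R) + 1 / (v + \<i> * of_real R)"
proof -
  have eq: "v\<^sup>2 + (of_real R)\<^sup>2 = (v - \<i> * of_real R) * (v + \<i> * of_real R)"
    by (simp add: power2_eq_square algebra_simps)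
  then have "v - \<i> * of_real R \<noteq> 0" "v + \<i> * of_real R \<noteq> 0" using assms by auto
  then show ?thesis unfolding eq by (simp add: divide_simps)
qed

text \<open>Both summands are, up to a constant, Poisson kernels of a half-plane with poles at
  \<open>\<plusminus> \<i> R\<close>. They have the sign of \<open>Re v\<close>, hence the
  exponential built from them decays exactly on the left.\<close>

lemma Re_two_poles:
  assumes "v\<^sup>2 + (of_real R)\<^sup>2 \<noteq> (0::complex)"
  shows "Re (2 * v / (v\<^sup>2 + (of_real R)\<^sup>2))
     = Re v / ((Re v)\<^sup>2 + (Im v - R)\<^sup>2) + Re v / ((Re v)\<^sup>2 + (Im v + R)\<^sup>2)"
  unfolding two_pole_partial_fractions[OF assms] by (simp add: Re_divide power2_eq_square)

text \<open>With \<open>t\<close> the vertical distance to the nearer corner, the edge condition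
  gives \<open>Re v \<le> 4 * t\<^sup>2 / R\<^sup>2\<close>, while both denominators are at least
  \<open>t\<^sup>2\<close>. Each kernel is thus at most \<open>4 / R\<^sup>2\<close>.\<close>

lemma Re_two_poles_le:
  assumes "0 < R" and y: "\<bar>Im v\<bar> < R" and x: "Re v \<le> (R\<^sup>2 - (Im v)\<^sup>2)\<^sup>2 / R ^ 4"
    and nz: "v\<^sup>2 + (of_real R)\<^sup>2 \<noteq> (0::complex)"
  shows "Re (2 * v / (v\<^sup>2 + (of_real R)\<^sup>2)) \<le> 8 / R\<^sup>2"
proof (cases "Re v \<le> 0")
  case True
  then have "Re (2 * v / (v\<^sup>2 + (of_real R)\<^sup>2)) \<le> 0"
    unfolding Re_two_poles[OF nz]
    by (intro add_nonpos_nonpos divide_nonpos_nonneg) auto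
  also have "0 \<le> 8 / R\<^sup>2" by simp
  finally show ?thesis .
next
  case False
  define t where "t = (R - \<bar>Im v\<bar>)"
  have t: "0 < t" using y by (simp add: t_def)
  have "R\<^sup>2 - (Im v)\<^sup>2 = t * (R + \<bar>Im v\<bar>)"
    by (simp add: t_def power2_eq_square algebra_simps flip: abs_mult)
  moreover have "t * (R + \<bar>Im v\<bar>) \<le> t * (2 * R)" using t y by (intro mult_left_mono) auto
  moreover have "0 \<le> t * (R + \<bar>Im v\<bar>)" using t y by auto
  ultimately have "(R\<^sup>2 - (Im v)\<^sup>2)\<^sup>2 \<le> (t * (2 * R))\<^sup>2" by (simp add: power_mono)
  then have "Re v \<le> (t * (2 * R))\<^sup>2 / R ^ 4"
    by (rule order.trans[OF x divide_right_mono]) simp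
  also have "\<dots> = 4 * t\<^sup>2 / R\<^sup>2" using \<open>0 < R\<close> by (simp add: power2_eq_square power4_eq_xxxx field_simps)
  finally have xt: "Re v / t\<^sup>2 \<le> 4 / R\<^sup>2" using t by (simp add: field_simps)
  have "t\<^sup>2 \<le> (Im v - R)\<^sup>2" "t\<^sup>2 \<le> (Im v + R)\<^sup>2"
    using t y by (auto simp: t_def abs_le_square_iff[symmetric] split: abs_split)
  then have "Re v / ((Re v)\<^sup>2 + (Im v - R)\<^sup>2) \<le> Re v / t\<^sup>2" "Re v / ((Re v)\<^sup>2 + (Im v + R)\<^sup>2) \<le> Re v / t\<^sup>2"
    using t False by (auto intro!: divide_left_mono add_increasing mult_pos_pos add_nonneg_pos
      simp: zero_less_power2 add_pos_nonneg sum_power2_gt_zero_iff)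
  then show ?thesis unfolding Re_two_poles[OF nz] using xt by simp
qed

text \<open>The factors \<open>v - \<i> R\<close> and \<open>v + \<i> R\<close> are controlled by 5
  times the distances \<open>t\<close> and \<open>w\<close> of \<open>Im v\<close> to the two
  corners, because \<open>Re v \<le> 4 * t\<close>. On the right edge the square of this bound is
  proportional to \<open>Re v\<close>, which cancels the singularity of the right-hand growth
  bound.\<close>

lemma cmod_add_square_le:
  assumes "1 \<le> R" and y: "\<bar>Im v\<bar> < R" and x: "0 \<le> Re v" "Re v \<le> (R\<^sup>2 - (Im v)\<^sup>2)\<^sup>2 / R ^ 4"
  shows "cmod (v\<^sup>2 + (of_real R)\<^sup>2) \<le> 25 * (R\<^sup>2 - (Im v)\<^sup>2)"
proof -
  define t where "t = (R - \<bar>Im v\<bar>)"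
  define w where "w = (R + \<bar>Im v\<bar>)"
  have t: "0 < t" "t \<le> R" "R \<le> w" "w \<le> 2 * R" "0 < w" using y assms(1) by (auto simp: t_def w_def)
  have tw: "R\<^sup>2 - (Im v)\<^sup>2 = t * w"
    by (simp add: t_def w_def power2_eq_square algebra_simps flip: abs_mult)
  have "t * w \<le> t * (2 * R)" "0 \<le> t * w" using t by auto
  then have "(t * w)\<^sup>2 \<le> (t * (2 * R))\<^sup>2" by (rule power_mono)
  then have "Re v \<le> (t * (2 * R))\<^sup>2 / R ^ 4"
    by (rule order.trans[OF x(2)[unfolded tw] divide_right_mono]) simp
  also have "\<dots> = 4 * t * (t / R) / R" using assms(1) by (simp add: power2_eq_square power4_eq_xxxx field_simps)
  also have "\<dots> \<le> 4 * t * 1 / 1"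
    using t assms(1) by (intro frac_le mult_left_mono) auto
  finally have xt: "Re v \<le> 4 * t" by simp
  have n1: "cmod (v - \<i> * of_real R) \<le> Re v + \<bar>Im v - R\<bar>"
    using cmod_le[of "v - \<i> * of_real R"] x(1) by simp
  have n2: "cmod (v + \<i> * of_real R) \<le> Re v + \<bar>Im v + R\<bar>"
    using cmod_le[of "v + \<i> * of_real R"] x(1) by simp
  have "v\<^sup>2 + (of_real R)\<^sup>2 = (v - \<i> * of_real R) * (v + \<i> * of_real R)"
    by (simp add: power2_eq_square algebra_simps)
  then have "cmod (v\<^sup>2 + (of_real R)\<^sup>2) = cmod (v - \<i> * of_real R) * cmod (v + \<i> * of_real R)"
    by (simp add: norm_mult)
  also have "\<dots> \<le> (Re v + \<bar>Im v - R\<bar>) * (Re v + \<bar>Im v + R\<bar>)"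
    using n1 n2 x by (intro mult_mono) auto
  also have "\<dots> = (Re v + t) * (Re v + w)"
    using y by (cases "0 \<le> Im v") (auto simp: t_def w_def)
  also have "\<dots> \<le> (5 * t) * (5 * w)"
    using xt t x by (intro mult_mono) auto
  finally show ?thesis unfolding tw by simp
qed

text \<open>
  The polynomial factor absorbs the blow-up of the bound near the imaginary axis and the exponential,
  whose exponent has poles at the corners \<open>\<plusminus> \<i> R\<close>, absorbs the bound in the left half-plane. The
  right edge \<open>Re v = (R\<^sup>2 - (Im v)\<^sup>2)\<^sup>2 / R ^ 4\<close> is tangent to the imaginary axis at the corners, so that
  the exponential factor stays bounded on it. At the corners the exponent is a division by zero,
  which is harmless since the polynomial factor vanishes there.
\<close>

lemma phragmen_lindelof_bounded_domain:
  fixes e :: "complex \<Rightarrow> complex"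
  assumes hol: "e holomorphic_on UNIV" and "0 \<le> K" "0 < N" "1 \<le> R" "0 \<le> \<epsilon>"
    and right: "\<And>v. 0 < Re v \<Longrightarrow> cmod (e v) \<le> K * ((cmod (1 + v))\<^sup>2 / Re v) ^ N"
    and left: "\<And>v. Re v < 0 \<Longrightarrow> cmod v \<le> R \<Longrightarrow> R \<le> 2 * cmod v \<Longrightarrow> cmod (e v) \<le> K * exp (\<epsilon> * R\<^sup>2 / - Re v)"
    and v: "\<bar>Im v\<bar> < R" "- (R - \<bar>Im v\<bar>) < Re v" "Re v < (R\<^sup>2 - (Im v)\<^sup>2)\<^sup>2 / R ^ 4"
  shows "cmod (e v * ((v\<^sup>2 + (of_real R)\<^sup>2) / (of_real R)\<^sup>2) ^ (2 * N) / (2 - v) ^ (2 * N)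
           * exp (of_real (2 * \<epsilon> * R\<^sup>2) * (2 * v / (v\<^sup>2 + (of_real R)\<^sup>2))))
         \<le> K * 5625 ^ N * exp (16 * \<epsilon>)"
proof -
  define \<Omega> where "\<Omega> = {v::complex. \<bar>Im v\<bar> < R \<and> - (R - \<bar>Im v\<bar>) < Re v \<and> Re v < (R\<^sup>2 - (Im v)\<^sup>2)\<^sup>2 / R ^ 4}"
  \<comment> \<open>An explicit closed superset of \<Omega>, which replaces its closure.\<close>
  define Q where "Q = {v::complex. \<bar>Im v\<bar> \<le> R \<and> - (R - \<bar>Im v\<bar>) \<le> Re v \<and> Re v \<le> (R\<^sup>2 - (Im v)\<^sup>2)\<^sup>2 / R ^ 4}"
  define A where "A = (\<lambda>v. e v * ((v\<^sup>2 + (of_real R)\<^sup>2) / (of_real R)\<^sup>2) ^ (2 * N) / (2 - v) ^ (2 * N))"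
  define H where "H = (\<lambda>v. exp (of_real (2 * \<epsilon> * R\<^sup>2) * (2 * v / (v\<^sup>2 + (of_real R)\<^sup>2))) :: complex)"
  define B where "B = K * 5625 ^ N * exp (16 * \<epsilon>)"
  have R: "0 < R" using assms by simp
  have "0 \<le> B" using assms by (simp add: B_def)
  have op: "open \<Omega>" unfolding \<Omega>_def
    by (intro open_Collect_conj open_Collect_less continuous_intros) (use R in auto)
  have cl: "closed Q" unfolding Q_def
    by (intro closed_Collect_conj closed_Collect_le continuous_intros) (use R in auto)
  have "\<Omega> \<subseteq> Q" by (auto simp: \<Omega>_def Q_def)
  then have clos: "closure \<Omega> \<subseteq> Q" using cl by (rule closure_minimal)
  have Re1: "Re v \<le> 1" if "v \<in> Q" for v
  proof -
    have "0 \<le> R\<^sup>2 - (Im v)\<^sup>2" "R\<^sup>2 - (Im v)\<^sup>2 \<le> R\<^sup>2"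
      using that R by (auto simp: Q_def abs_le_square_iff[symmetric])
    then have "(R\<^sup>2 - (Im v)\<^sup>2)\<^sup>2 \<le> (R\<^sup>2)\<^sup>2" by (intro power_mono)
    then have "(R\<^sup>2 - (Im v)\<^sup>2)\<^sup>2 / R ^ 4 \<le> 1" using R by simp
    then show ?thesis using that by (simp add: Q_def)
  qed
  then have n2: "v \<noteq> 2" if "v \<in> Q" for v using that by force
  have corner: "\<bar>Im v\<bar> = R \<longleftrightarrow> v\<^sup>2 + (of_real R)\<^sup>2 = 0" if "v \<in> Q" for v
  proof
    assume *: "\<bar>Im v\<bar> = R"
    then have "(Im v)\<^sup>2 = R\<^sup>2" by (metis power2_abs)
    then have "Re v = 0" using that * by (auto simp: Q_def)
    then show "v\<^sup>2 + (of_real R)\<^sup>2 = 0" using \<open>(Im v)\<^sup>2 = R\<^sup>2\<close>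
      by (simp add: complex_eq_iff power2_eq_square)
  next
    assume "v\<^sup>2 + (of_real R)\<^sup>2 = 0"
    then have "(v - \<i> * of_real R) * (v + \<i> * of_real R) = 0"
      by (simp add: power2_eq_square algebra_simps)
    then have "v = \<i> * of_real R \<or> v = - (\<i> * of_real R)" by (auto simp: eq_neg_iff_add_eq_0)
    then show "\<bar>Im v\<bar> = R" using R by auto
  qed
  have H_le: "cmod (H v) \<le> exp (16 * \<epsilon>)" if "v \<in> Q" for v
  proof (cases "v\<^sup>2 + (of_real R)\<^sup>2 = 0")
    case True
    then show ?thesis using assms by (simp add: H_def)
  next
    case False
    then have "Re (2 * v / (v\<^sup>2 + (of_real R)\<^sup>2)) \<le> 8 / R\<^sup>2"
      using corner[OF that] that R by (intro Re_two_poles_le) (auto simp: Q_def)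
    then have "(2 * \<epsilon> * R\<^sup>2) * Re (2 * v / (v\<^sup>2 + (of_real R)\<^sup>2)) \<le> (2 * \<epsilon> * R\<^sup>2) * (8 / R\<^sup>2)"
      using assms by (intro mult_left_mono) auto
    also have "\<dots> = 16 * \<epsilon>" using R by simp
    finally show ?thesis unfolding H_def norm_exp_eq_Re
      by (metis exp_le_cancel_iff Re_complex_of_real times_complex.sel(1) Im_complex_of_real mult_zero_left diff_zero)
  qed
  have A_cont: "continuous_on Q A" unfolding A_def
    by (intro continuous_intros holomorphic_on_imp_continuous_on holomorphic_on_subset[OF hol])
       (use n2 R in auto)
  \<comment> \<open>At the corners \<open>H\<close> need not be continuous, but it stays bounded on
    \<open>Q\<close> and \<open>A\<close> tends to 0.\<close>
  have G_cont: "continuous_on Q (\<lambda>v. A v * H v)"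
    unfolding continuous_on_eq_continuous_within
  proof
    fix c assume c: "c \<in> Q"
    have Ac: "continuous (at c within Q) A"
      using A_cont c by (simp add: continuous_on_eq_continuous_within)
    show "continuous (at c within Q) (\<lambda>v. A v * H v)"
    proof (cases "c\<^sup>2 + (of_real R)\<^sup>2 = 0")
      case True
      then have "A c = 0" using \<open>0 < N\<close> by (simp add: A_def)
      then have "(A \<longlongrightarrow> 0) (at c within Q)" using Ac by (simp add: continuous_within)
      then have "((\<lambda>v. exp (16 * \<epsilon>) * cmod (A v)) \<longlongrightarrow> exp (16 * \<epsilon>) * 0) (at c within Q)"
        by (intro tendsto_intros tendsto_norm_zero)
      then have "((\<lambda>v. exp (16 * \<epsilon>) * cmod (A v)) \<longlongrightarrow> 0) (at c within Q)" by simp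
      then have "((\<lambda>v. A v * H v) \<longlongrightarrow> 0) (at c within Q)"
      proof (rule Lim_null_comparison[rotated])
        show "\<forall>\<^sub>F v in at c within Q. cmod (A v * H v) \<le> exp (16 * \<epsilon>) * cmod (A v)"
          unfolding eventually_at_filter
          by (intro always_eventually allI impI)
             (simp add: norm_mult mult.commute[of "exp _"] mult_left_mono H_le)
      qed
      then show ?thesis using \<open>A c = 0\<close> by (simp add: continuous_within)
    next
      case False
      then have "continuous (at c within Q) H" unfolding H_def by (intro continuous_intros)
      then show ?thesis using Ac by (intro continuous_mult)
    qed
  qed
  have G_hol: "(\<lambda>v. A v * H v) holomorphic_on \<Omega>"
    unfolding A_def H_def
    by (intro holomorphic_intros holomorphic_on_subset[OF hol])
       (use n2 R corner \<open>\<Omega> \<subseteq> Q\<close> in \<open>auto simp: \<Omega>_def\<close>)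
  have R4: "R ^ 4 = (R\<^sup>2)\<^sup>2" by simp
  have frontier: "cmod (A w * H w) \<le> B" if "w \<in> frontier \<Omega>" for w
  proof -
    have wQ: "w \<in> Q" and wn: "w \<notin> \<Omega>" using that clos op by (auto simp: frontier_def interior_open)
    consider (c) "\<bar>Im w\<bar> = R" | (l) "\<bar>Im w\<bar> < R" "Re w = - (R - \<bar>Im w\<bar>)"
      | (r) "\<bar>Im w\<bar> < R" "Re w = (R\<^sup>2 - (Im w)\<^sup>2)\<^sup>2 / R ^ 4"
      using wQ wn by (fastforce simp: Q_def \<Omega>_def)
    then show ?thesis
    proof cases
      case c
      then have "A w = 0" using corner[OF wQ] \<open>0 < N\<close> by (simp add: A_def)
      then show ?thesis using \<open>0 \<le> B\<close> by simp
    next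
      case l
      define s where "s = - Re w"
      have s: "0 < s" "\<bar>Im w\<bar> = R - s" "Re w = - s" "s \<le> R" using l by (auto simp: s_def)
      have nz: "w\<^sup>2 + (of_real R)\<^sup>2 \<noteq> 0" using l corner[OF wQ] by auto
      have norm: "cmod w \<le> R" "R \<le> 2 * cmod w"
        using cmod_le[of w] abs_Re_le_cmod[of w] abs_Im_le_cmod[of w] s by auto
      have e: "cmod (e w) \<le> K * exp (\<epsilon> * R\<^sup>2 / s)" using left[of w] norm s by simp
      have "cmod (w\<^sup>2 + (of_real R)\<^sup>2) \<le> (cmod w)\<^sup>2 + R\<^sup>2"
        using norm_triangle_ineq[of "w\<^sup>2" "(of_real R)\<^sup>2"] R by (simp add: norm_power)
      also have "\<dots> \<le> R\<^sup>2 + R\<^sup>2" using norm by (intro add_mono power_mono) auto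
      finally have "cmod ((w\<^sup>2 + (of_real R)\<^sup>2) / (of_real R)\<^sup>2) \<le> 2"
        using R by (simp add: norm_divide norm_power field_simps)
      then have wt: "cmod ((w\<^sup>2 + (of_real R)\<^sup>2) / (of_real R)\<^sup>2) ^ (2 * N) \<le> 2 ^ (2 * N)"
        by (intro power_mono) auto
      have "1 \<le> cmod (2 - w)" using complex_Re_le_cmod[of "2 - w"] s by simp
      then have den: "1 \<le> cmod (2 - w) ^ (2 * N)" by (rule one_le_power)
      have A: "cmod (A w) \<le> K * exp (\<epsilon> * R\<^sup>2 / s) * 4 ^ N"
      proof -
        have "cmod (A w) \<le> cmod (e w) * cmod ((w\<^sup>2 + (of_real R)\<^sup>2) / (of_real R)\<^sup>2) ^ (2 * N) / 1"
          unfolding A_def norm_mult norm_divide norm_power using den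
          by (intro divide_left_mono) auto
        also have "\<dots> \<le> (K * exp (\<epsilon> * R\<^sup>2 / s)) * 2 ^ (2 * N)"
          using e wt \<open>0 \<le> K\<close> by (simp only: div_by_1, intro mult_mono) auto
        finally show ?thesis by (simp add: power_mult)
      qed
      \<comment> \<open>On the left edges the nearer corner is at vertical distance \<open>s\<close>
        as well, so its kernel equals \<open>- s / (s\<^sup>2 + s\<^sup>2)\<close>. Multiplied by
        \<open>2 * \<epsilon> * R\<^sup>2\<close> it cancels the exponent of the left bound.\<close>
      have "Re (2 * w / (w\<^sup>2 + (of_real R)\<^sup>2)) \<le> - 1 / (2 * s)"
      proof -
        have "- s / (s\<^sup>2 + s\<^sup>2) = - 1 / (2 * s)" using s by (simp add: power2_eq_square field_simps)
        moreover have "- s / (s\<^sup>2 + D) \<le> 0" if "0 \<le> D" for D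
          using s that by (intro divide_nonpos_nonneg) auto
        moreover have "(Im w - R)\<^sup>2 = s\<^sup>2 \<or> (Im w + R)\<^sup>2 = s\<^sup>2"
          using s by (cases "0 \<le> Im w") (auto simp: power2_eq_iff)
        ultimately show ?thesis unfolding Re_two_poles[OF nz] s
          by (elim disjE) (auto intro: add_decreasing add_decreasing2)
      qed
      then have "(2 * \<epsilon> * R\<^sup>2) * Re (2 * w / (w\<^sup>2 + (of_real R)\<^sup>2)) \<le> (2 * \<epsilon> * R\<^sup>2) * (- 1 / (2 * s))"
        using assms by (intro mult_left_mono) auto
      also have "\<dots> = - (\<epsilon> * R\<^sup>2 / s)" by simp
      finally have "cmod (H w) \<le> exp (- (\<epsilon> * R\<^sup>2 / s))" unfolding H_def norm_exp_eq_Re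
        by (metis exp_le_cancel_iff Re_complex_of_real times_complex.sel(1) Im_complex_of_real mult_zero_left diff_zero)
      then have "cmod (A w * H w) \<le> (K * exp (\<epsilon> * R\<^sup>2 / s) * 4 ^ N) * exp (- (\<epsilon> * R\<^sup>2 / s))"
        unfolding norm_mult using A assms by (intro mult_mono) auto
      also have "\<dots> = K * 4 ^ N * 1" by (simp add: exp_minus)
      also have "\<dots> \<le> B" unfolding B_def using assms by (intro mult_mono power_mono) auto
      finally show ?thesis .
    next
      case r
      define x where "x = Re w"
      have "(Im w)\<^sup>2 < R\<^sup>2" using r R power_strict_mono[of "\<bar>Im w\<bar>" R 2] by simp
      then have x: "0 < x" "x \<le> 1" using r Re1[OF wQ] R by (auto simp: x_def)
      have "cmod (w\<^sup>2 + (of_real R)\<^sup>2) \<le> 25 * (R\<^sup>2 - (Im w)\<^sup>2)"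
        using r R x assms by (intro cmod_add_square_le) (auto simp: x_def)
      then have "(cmod (w\<^sup>2 + (of_real R)\<^sup>2))\<^sup>2 \<le> (25 * (R\<^sup>2 - (Im w)\<^sup>2))\<^sup>2"
        by (rule power_mono) auto
      \<comment> \<open>The equation of the right edge:
        \<open>(R\<^sup>2 - (Im w)\<^sup>2)\<^sup>2 = x * R ^ 4\<close>.\<close>
      also have "\<dots> = 625 * x * (R\<^sup>2)\<^sup>2" using r R by (simp only: x_def power_mult_distrib) simp
      finally have wt: "(cmod ((w\<^sup>2 + (of_real R)\<^sup>2) / (of_real R)\<^sup>2))\<^sup>2 \<le> 625 * x"
        using R by (simp add: norm_divide norm_power power_divide pos_divide_le_eq)
      have e: "cmod (e w) \<le> K * ((cmod (1 + w))\<^sup>2 / x) ^ N" using right[of w] x by (simp add: x_def)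
      have "1 \<le> cmod (2 - w)" using complex_Re_le_cmod[of "2 - w"] x by (simp add: x_def)
      \<comment> \<open>The denominator \<open>2 - v\<close> absorbs the growth of
        \<open>1 + v\<close>. The factor 3 here and the 25 of the polynomial weight make
        \<open>5625 = 9 * 625\<close>.\<close>
      moreover have "cmod (1 + w) \<le> 3 * cmod (2 - w)"
      proof -
        have "(1 + x)\<^sup>2 \<le> (2 * (2 - x))\<^sup>2" using x by (intro power_mono) auto
        then have "(1 + x)\<^sup>2 + (Im w)\<^sup>2 \<le> 2\<^sup>2 * (2 - x)\<^sup>2 + 4 * (Im w)\<^sup>2"
          unfolding power_mult_distrib by (intro add_mono) auto
        then have "(cmod (1 + w))\<^sup>2 \<le> (2 * cmod (2 - w))\<^sup>2"
          by (simp add: cmod_power2 power_mult_distrib x_def)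
        then have "cmod (1 + w) \<le> 2 * cmod (2 - w)" by (rule power2_le_imp_le) auto
        then show ?thesis by (rule order.trans) simp
      qed
      ultimately have den: "0 < cmod (2 - w)" "(cmod (1 + w))\<^sup>2 \<le> 9 * (cmod (2 - w))\<^sup>2"
        using power_mono[of "cmod (1 + w)" "3 * cmod (2 - w)" 2] by (auto simp: power_mult_distrib)
      have "cmod (A w) = cmod (e w) * ((cmod ((w\<^sup>2 + (of_real R)\<^sup>2) / (of_real R)\<^sup>2))\<^sup>2) ^ N / ((cmod (2 - w))\<^sup>2) ^ N"
        by (simp add: A_def norm_mult norm_divide norm_power power_mult)
      also have "\<dots> \<le> (K * ((cmod (1 + w))\<^sup>2 / x) ^ N) * (625 * x) ^ N / ((cmod (2 - w))\<^sup>2) ^ N"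
        using e wt assms x by (intro divide_right_mono mult_mono power_mono) auto
      also have "\<dots> = K * (625 * (cmod (1 + w))\<^sup>2 / (cmod (2 - w))\<^sup>2) ^ N"
        using x by (simp add: power_mult_distrib power_divide)
      also have "\<dots> \<le> K * 5625 ^ N"
        using den assms by (intro mult_left_mono power_mono) (auto simp: pos_divide_le_eq)
      finally show ?thesis
        unfolding B_def norm_mult using H_le[OF wQ] assms by (intro mult_mono) auto
    qed
  qed
  have "bounded \<Omega>"
    unfolding bounded_iff
  proof (intro exI ballI)
    fix w assume "w \<in> \<Omega>"
    then show "cmod w \<le> 2 * R + 1"
      using cmod_le[of w] Re1[of w] \<open>\<Omega> \<subseteq> Q\<close> by (auto simp: \<Omega>_def)
  qed
  have "cmod (A v * H v) \<le> B"
  proof (rule maximum_modulus_frontier[where f = "\<lambda>v. A v * H v" and S = \<Omega>])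
    show "(\<lambda>v. A v * H v) holomorphic_on interior \<Omega>" using G_hol op by (simp add: interior_open)
    show "continuous_on (closure \<Omega>) (\<lambda>v. A v * H v)" by (rule continuous_on_subset[OF G_cont clos])
    show "v \<in> \<Omega>" using v by (simp add: \<Omega>_def)
  qed (fact \<open>bounded \<Omega>\<close> frontier)+
  then show ?thesis by (simp add: A_def H_def B_def)
qed

lemma phragmen_lindelof_polynomial_growth:
  fixes e :: "complex \<Rightarrow> complex"
  assumes hol: "e holomorphic_on UNIV" and "0 \<le> K" "0 < N"
    and right: "\<And>v. 0 < Re v \<Longrightarrow> cmod (e v) \<le> K * ((cmod (1 + v))\<^sup>2 / Re v) ^ N"
    and left: "\<And>\<epsilon>. 0 < \<epsilon> \<Longrightarrow> \<exists>R\<^sub>0. \<forall>v. Re v < 0 \<longrightarrow> R\<^sub>0 \<le> cmod v \<longrightarrow>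
                 cmod (e v) \<le> K * exp (\<epsilon> * (cmod v)\<^sup>2 / - Re v)"
  shows "\<exists>C. \<forall>v. cmod (e v) \<le> C * (2 + cmod v) ^ (2 * N)"
proof -
  \<comment> \<open>For fixed \<open>v\<close> and \<open>\<epsilon>\<close> the bound on the bounded domain survives the limit \<open>R \<rightarrow> \<infinity>\<close>, after which \<open>\<epsilon> \<rightarrow> 0\<close>.\<close>
  define B where "B = K * 5625 ^ N * exp 16"
  \<comment> \<open>The restriction \<open>Re v < 1\<close> appears because the right edge tends to
    the line \<open>Re v = 1\<close> as \<open>R\<close> grows. For \<open>Re v \<ge> 1\<close> the
    hypothesis \<open>right\<close> is already polynomial.\<close>
  have main: "cmod (e v) \<le> B * cmod (2 - v) ^ (2 * N)" if v: "Re v < 1" for v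
  proof -
    have d: "0 < cmod (2 - v)" using v by auto
    have step: "cmod (e v) / cmod (2 - v) ^ (2 * N) * exp (4 * \<epsilon> * Re v) \<le> B"
      if \<epsilon>: "0 < \<epsilon>" "\<epsilon> \<le> 1" for \<epsilon>
    proof -
      obtain R\<^sub>0 where R0: "\<And>v. Re v < 0 \<Longrightarrow> R\<^sub>0 \<le> cmod v \<Longrightarrow>
                 cmod (e v) \<le> K * exp (\<epsilon> * (cmod v)\<^sup>2 / - Re v)"
        using left[OF \<epsilon>(1)] by blast
      define F where "F = (\<lambda>R. cmod (e v * ((v\<^sup>2 + (of_real R)\<^sup>2) / (of_real R)\<^sup>2) ^ (2 * N) / (2 - v) ^ (2 * N)
           * exp (of_real (2 * \<epsilon> * R\<^sup>2) * (2 * v / (v\<^sup>2 + (of_real R)\<^sup>2)))))"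
      have inv: "((\<lambda>R. v\<^sup>2 / (of_real R)\<^sup>2) \<longlongrightarrow> 0) at_top"
      proof (rule Lim_null_comparison)
        show "\<forall>\<^sub>F R in at_top. cmod (v\<^sup>2 / (of_real R)\<^sup>2) \<le> (cmod v)\<^sup>2 / R\<^sup>2"
          by (intro always_eventually) (simp add: norm_divide norm_power)
        show "((\<lambda>R. (cmod v)\<^sup>2 / R\<^sup>2) \<longlongrightarrow> 0) at_top" by real_asymp
      qed
      \<comment> \<open>Dividing through by \<open>R\<^sup>2\<close> shows that the polynomial
        weight tends to 1 and the exponential factor to
        \<open>exp (4 * \<epsilon> * v)\<close>.\<close>
      have "((\<lambda>R. cmod (e v * (v\<^sup>2 / (of_real R)\<^sup>2 + 1) ^ (2 * N) / (2 - v) ^ (2 * N)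
           * exp (of_real (4 * \<epsilon>) * v / (v\<^sup>2 / (of_real R)\<^sup>2 + 1)))) \<longlongrightarrow>
         cmod (e v * (0 + 1) ^ (2 * N) / (2 - v) ^ (2 * N) * exp (of_real (4 * \<epsilon>) * v / (0 + 1)))) at_top"
        using d by (intro tendsto_intros inv) auto
      moreover have "\<forall>\<^sub>F R in at_top. cmod (e v * (v\<^sup>2 / (of_real R)\<^sup>2 + 1) ^ (2 * N) / (2 - v) ^ (2 * N)
           * exp (of_real (4 * \<epsilon>) * v / (v\<^sup>2 / (of_real R)\<^sup>2 + 1))) = F R"
        using eventually_gt_at_top[of 0]
      proof eventually_elim
        case (elim R)
        have "v\<^sup>2 / (of_real R)\<^sup>2 + 1 = (v\<^sup>2 + (of_real R)\<^sup>2) / (of_real R)\<^sup>2"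
          using elim by (simp add: add_divide_distrib)
        then show ?case by (simp add: F_def mult_ac)
      qed
      ultimately have "(F \<longlongrightarrow> cmod (e v) / cmod (2 - v) ^ (2 * N) * exp (4 * \<epsilon> * Re v)) at_top"
        by (auto simp: norm_mult norm_divide norm_power elim!: Lim_transform_eventually)
      moreover have "\<forall>\<^sub>F R in at_top. F R \<le> B"
      proof -
        have "\<forall>\<^sub>F R in at_top. Re v < (R\<^sup>2 - (Im v)\<^sup>2)\<^sup>2 / R ^ 4"
        proof -
          have "((\<lambda>R. (R\<^sup>2 - (Im v)\<^sup>2)\<^sup>2 / R ^ 4) \<longlongrightarrow> 1) at_top" by real_asymp
          then show ?thesis using v by (rule order_tendstoD)
        qed
        then show ?thesis
          \<comment> \<open>The first threshold puts \<open>v\<close> to the right of the left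
            edges. The second makes the hypothesis available there, since points of these edges have
            modulus at least \<open>R / 2\<close>.\<close>
          using eventually_ge_at_top[of "1 + \<bar>Im v\<bar> + \<bar>Re v\<bar>"] eventually_ge_at_top[of "2 * R\<^sub>0"]
        proof eventually_elim
          case (elim R)
          have "F R \<le> K * 5625 ^ N * exp (16 * \<epsilon>)"
            unfolding F_def
          proof (rule phragmen_lindelof_bounded_domain[OF hol \<open>0 \<le> K\<close> \<open>0 < N\<close> _ _ right])
            fix w assume w: "Re w < 0" "cmod w \<le> R" "R \<le> 2 * cmod w"
            have "cmod (e w) \<le> K * exp (\<epsilon> * (cmod w)\<^sup>2 / - Re w)"
              using w elim by (intro R0) auto
            also have "\<dots> \<le> K * exp (\<epsilon> * R\<^sup>2 / - Re w)"
              using w \<epsilon> \<open>0 \<le> K\<close> by (intro mult_left_mono exp_mono divide_right_mono power_mono) auto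
            finally show "cmod (e w) \<le> K * exp (\<epsilon> * R\<^sup>2 / - Re w)" .
          qed (use elim \<epsilon> in auto)
          also have "\<dots> \<le> B" unfolding B_def using \<epsilon> \<open>0 \<le> K\<close> by (intro mult_left_mono) auto
          finally show ?case .
        qed
      qed
      ultimately show ?thesis by (intro tendsto_upperbound) auto
    qed
    have "((\<lambda>\<epsilon>. cmod (e v) / cmod (2 - v) ^ (2 * N) * exp (4 * \<epsilon> * Re v)) \<longlongrightarrow>
        cmod (e v) / cmod (2 - v) ^ (2 * N) * exp (4 * 0 * Re v)) (at_right 0)"
      by (intro tendsto_intros)
    moreover have "\<forall>\<^sub>F \<epsilon> in at_right 0. cmod (e v) / cmod (2 - v) ^ (2 * N) * exp (4 * \<epsilon> * Re v) \<le> B"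
      unfolding eventually_at_right_field by (intro exI[of _ 1]) (simp add: step[simplified])
    ultimately have "cmod (e v) / cmod (2 - v) ^ (2 * N) * exp (4 * 0 * Re v) \<le> B"
      by (intro tendsto_upperbound) auto
    then show ?thesis using d by (simp add: pos_divide_le_eq)
  qed
  have "0 \<le> B" using assms by (simp add: B_def)
  have "cmod (e v) \<le> (B + K) * (2 + cmod v) ^ (2 * N)" for v
  proof (cases "Re v < 1")
    case True
    have "cmod (e v) \<le> B * (2 + cmod v) ^ (2 * N)"
      using norm_triangle_ineq4[of 2 v]
      by (intro order.trans[OF main[OF True]] mult_left_mono power_mono) (use \<open>0 \<le> B\<close> in auto)
    then show ?thesis using \<open>0 \<le> K\<close> by (simp add: distrib_right add_increasing2)
  next
    case False
    have n: "cmod (1 + v) \<le> 2 + cmod v" using norm_triangle_ineq[of 1 v] by simp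
    have "cmod (e v) \<le> K * ((cmod (1 + v))\<^sup>2 / Re v) ^ N" using False by (intro right) auto
    also have "\<dots> \<le> K * ((2 + cmod v)\<^sup>2 / 1) ^ N"
      using False n \<open>0 \<le> K\<close> by (intro mult_left_mono power_mono frac_le) auto
    finally show ?thesis using \<open>0 \<le> B\<close> by (simp add: power_mult distrib_right add_increasing)
  qed
  then show ?thesis by blast
qed

subsection \<open>Lower bounds for outer functions\<close>

lemma sets_circle_measure [measurable_cong]: "sets circle_measure = sets borel"
  by (simp add: circle_measure_def)

lemma AE_circle_measure_iff:
  assumes [measurable]: "Measurable.pred borel P"
  shows "(AE \<xi> in circle_measure. P \<xi>) \<longleftrightarrow> (AE t in lborel. t \<in> {0..<2 * pi} \<longrightarrow> P (cis t))"
proof -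
  have [measurable]: "cis \<in> borel_measurable borel"
    by (intro borel_measurable_continuous_onI continuous_intros)
  have "(AE \<xi> in circle_measure. P \<xi>) \<longleftrightarrow> (AE t in uniform_measure lborel {0..<2 * pi}. P (cis t))"
    unfolding circle_measure_def
  proof (rule AE_distr_iff)
    show "{\<xi> \<in> space borel. P \<xi>} \<in> sets borel" using assms by (simp only: pred_def)
  qed measurable
  also have "\<dots> \<longleftrightarrow> (AE t in lborel. t \<in> {0..<2 * pi} \<longrightarrow> P (cis t))"
    by (intro AE_uniform_measure) auto
  finally show ?thesis .
qed

lemma AE_circle_measure_norm: "AE \<xi> in circle_measure. cmod \<xi> = 1"
  by (subst AE_circle_measure_iff) auto

lemma AE_circle_measure_neq: "AE \<xi> in circle_measure. \<xi> \<noteq> \<zeta>"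
proof (subst AE_circle_measure_iff)
  show "AE t in lborel. t \<in> {0..<2 * pi} \<longrightarrow> cis t \<noteq> \<zeta>"
    using AE_lborel_singleton[of "Arg2pi \<zeta>"]
  proof eventually_elim
    case (elim t)
    then show ?case
      using Arg2pi_unique[of 1 t \<zeta>] by (auto simp: cis_conv_exp)
  qed
qed simp

lemma outer_nonzero:
  assumes "outer f" "z \<in> ball 0 1"
  shows "f z \<noteq> 0"
  using assms unfolding outer_def by force

text \<open>Multiplied by \<open>1 - cmod z\<close>, the Herglotz kernel is bounded by 2 on the
  circle and tends to 0 for every \<open>\<xi> \<noteq> \<zeta>\<close> as \<open>z\<close> tends to
  \<zeta>. Dominated convergence then says that the exponent of \<open>f\<close> is o(1 / (1 -
  |z|)), for any approach to \<zeta> within the disc.\<close>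

lemma outer_lower_bound:
  assumes "outer f" and "0 < \<epsilon>" and \<zeta>: "\<zeta> \<in> sphere 0 1"
  shows "\<exists>\<eta>>0. \<forall>z\<in>ball 0 1. cmod (z - \<zeta>) < \<eta> \<longrightarrow> exp (- \<epsilon> / (1 - cmod z)) \<le> cmod (f z)"
proof -
  obtain c \<phi> where c: "cmod c = 1"
    and [measurable]: "\<phi> \<in> borel_measurable circle_measure"
    and int: "integrable circle_measure (\<lambda>\<xi>. ln (\<phi> \<xi>))"
    and f: "\<And>z. z \<in> ball 0 1 \<Longrightarrow>
      f z = c * exp (LINT \<xi>|circle_measure. (\<xi> + z) / (\<xi> - z) * of_real (ln (\<phi> \<xi>)))"
    using \<open>outer f\<close> unfolding outer_def by blast
  define h where "h = (\<lambda>z \<xi>. of_real (1 - cmod z) * ((\<xi> + z) / (\<xi> - z) * complex_of_real (ln (\<phi> \<xi>))))"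
  have bound: "cmod (h z \<xi>) \<le> 2 * \<bar>ln (\<phi> \<xi>)\<bar>" if "cmod \<xi> = 1" "z \<in> ball 0 1" for z \<xi>
  proof -
    have "cmod (\<xi> + z) \<le> 2" using norm_triangle_ineq[of \<xi> z] that by simp
    moreover have d: "1 - cmod z \<le> cmod (\<xi> - z)" "0 < 1 - cmod z"
      using norm_triangle_ineq2[of \<xi> z] that by auto
    ultimately have "(1 - cmod z) * cmod (\<xi> + z) \<le> cmod (\<xi> - z) * 2"
      by (intro mult_mono) auto
    then have "(1 - cmod z) * (cmod (\<xi> + z) / cmod (\<xi> - z)) \<le> 2"
      using d by (simp add: divide_le_eq mult.commute)
    then have "(1 - cmod z) * (cmod (\<xi> + z) / cmod (\<xi> - z)) * \<bar>ln (\<phi> \<xi>)\<bar> \<le> 2 * \<bar>ln (\<phi> \<xi>)\<bar>"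
      by (rule mult_right_mono) simp
    then show ?thesis using d by (simp add: h_def norm_mult norm_divide del: of_real_diff)
  qed
  have "((\<lambda>z. LINT \<xi>|circle_measure. h z \<xi>) \<longlongrightarrow> 0) (at \<zeta> within ball 0 1)"
    unfolding tendsto_at_iff_sequentially
  proof (intro allI impI)
    fix Z assume Z: "\<forall>i. Z i \<in> ball 0 1 - {\<zeta>}" "Z \<longlonglongrightarrow> \<zeta>"
    have "(\<lambda>n. LINT \<xi>|circle_measure. h (Z n) \<xi>) \<longlonglongrightarrow> (LINT \<xi>|circle_measure. 0)"
    proof (rule integral_dominated_convergence)
      show "integrable circle_measure (\<lambda>\<xi>. 2 * \<bar>ln (\<phi> \<xi>)\<bar>)" using int by auto
      show "AE \<xi> in circle_measure. (\<lambda>n. h (Z n) \<xi>) \<longlonglongrightarrow> 0"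
        using AE_circle_measure_neq[of \<zeta>]
      proof eventually_elim
        case (elim \<xi>)
        have "(\<lambda>n. h (Z n) \<xi>) \<longlonglongrightarrow>
          of_real (1 - cmod \<zeta>) * ((\<xi> + \<zeta>) / (\<xi> - \<zeta>) * complex_of_real (ln (\<phi> \<xi>)))"
          unfolding h_def using elim by (intro tendsto_intros Z) auto
        then show ?case using \<zeta> by simp
      qed
      show "AE \<xi> in circle_measure. cmod (h (Z n) \<xi>) \<le> 2 * \<bar>ln (\<phi> \<xi>)\<bar>" for n
        using AE_circle_measure_norm by eventually_elim (use Z in \<open>auto intro: bound\<close>)
    qed (auto simp: h_def)
    then show "((\<lambda>z. LINT \<xi>|circle_measure. h z \<xi>) \<circ> Z) \<longlonglongrightarrow> 0" by (simp add: o_def)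
  qed
  then obtain \<eta> where \<eta>: "0 < \<eta>"
    "\<And>z. z \<in> ball 0 1 \<Longrightarrow> 0 < dist z \<zeta> \<Longrightarrow> dist z \<zeta> < \<eta> \<Longrightarrow> cmod (LINT \<xi>|circle_measure. h z \<xi>) < \<epsilon>"
    using \<open>0 < \<epsilon>\<close> unfolding Lim_within by (force simp: dist_norm)
  have "exp (- \<epsilon> / (1 - cmod z)) \<le> cmod (f z)" if z: "z \<in> ball 0 1" and "cmod (z - \<zeta>) < \<eta>" for z
  proof -
    define J where "J = (LINT \<xi>|circle_measure. (\<xi> + z) / (\<xi> - z) * complex_of_real (ln (\<phi> \<xi>)))"
    have pos: "0 < 1 - cmod z" using z by simp
    have "z \<noteq> \<zeta>" using z \<zeta> by auto
    then have "cmod (LINT \<xi>|circle_measure. h z \<xi>) < \<epsilon>"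
      using that by (intro \<eta>) (auto simp: dist_norm)
    moreover have "(LINT \<xi>|circle_measure. h z \<xi>) = of_real (1 - cmod z) * J"
      unfolding h_def J_def by (rule integral_mult_right_zero)
    ultimately have "(1 - cmod z) * cmod J < \<epsilon>"
      using pos by (simp add: norm_mult del: of_real_diff)
    then have "cmod J < \<epsilon> / (1 - cmod z)" using pos by (simp add: pos_less_divide_eq mult.commute)
    then have "- \<epsilon> / (1 - cmod z) \<le> Re J" using abs_Re_le_cmod[of J] by simp
    then show ?thesis using f[OF z] c by (simp add: norm_mult norm_exp_eq_Re J_def)
  qed
  then show ?thesis using \<eta>(1) by blast
qed

subsection \<open>Resolvent estimates\<close>

text \<open>Summation by parts trades one power of \<open>n + 1\<close> for a factor
  \<open>(p + 1) / (1 - r)\<close>.\<close>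

lemma sum_power_geometric_bound:
  fixes r :: real
  assumes "0 \<le> r" "r < 1"
  shows "(\<Sum>n<m. real (n + 1) ^ p * r ^ n) \<le> fact p / (1 - r) ^ (p + 1)"
proof (induction p)
  case 0
  have "(\<Sum>n<m. r ^ n) = (1 - r ^ m) / (1 - r)"
    using assms by (simp add: sum_gp_strict)
  also have "\<dots> \<le> 1 / (1 - r)"
    using assms by (intro divide_right_mono) auto
  finally show ?case by simp
next
  case (Suc p)
  define S where "S = (\<lambda>q m. \<Sum>n<m. real (n + 1) ^ q * r ^ n)"
  have diff: "real (n + 1) ^ Suc p - real n ^ Suc p \<le> real (Suc p) * real (n + 1) ^ p" for n
  proof -
    have "real (n + 1) ^ Suc p - real n ^ Suc p
        = (\<Sum>i<Suc p. real n ^ (p - i) * real (n + 1) ^ i)"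
      using power_diff_sumr2[of "real (n + 1)" "Suc p" "real n"]
      by (simp add: mult.commute del: power_Suc sum.lessThan_Suc)
    also have "\<dots> \<le> (\<Sum>i<Suc p. real (n + 1) ^ (p - i) * real (n + 1) ^ i)"
      by (intro sum_mono mult_right_mono power_mono) auto
    also have "\<dots> = (\<Sum>i<Suc p. real (n + 1) ^ p)"
      by (intro sum.cong) (auto simp flip: power_add)
    finally show ?thesis by simp
  qed
  have abel: "(1 - r) * S (Suc p) m
      = (\<Sum>n<m. (real (n + 1) ^ Suc p - real n ^ Suc p) * r ^ n) - real m ^ Suc p * r ^ m" for m
    by (induction m) (auto simp: S_def algebra_simps)
  have "(1 - r) * S (Suc p) m \<le> (\<Sum>n<m. (real (n + 1) ^ Suc p - real n ^ Suc p) * r ^ n)"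
    unfolding abel using assms by simp
  also have "\<dots> \<le> (\<Sum>n<m. (real (Suc p) * real (n + 1) ^ p) * r ^ n)"
    using assms by (intro sum_mono mult_right_mono diff) auto
  also have "\<dots> = real (Suc p) * S p m"
    by (simp add: S_def sum_distrib_left mult.assoc)
  also have "\<dots> \<le> real (Suc p) * (fact p / (1 - r) ^ (p + 1))"
    using Suc.IH by (intro mult_left_mono) (auto simp: S_def)
  finally have "S (Suc p) m \<le> real (Suc p) * (fact p / (1 - r) ^ (p + 1)) / (1 - r)"
    using assms by (subst pos_le_divide_eq) (auto simp: mult.commute)
  also have "\<dots> = fact (Suc p) / (1 - r) ^ (Suc p + 1)" by simp
  finally show ?case by (simp only: S_def)
qed

text \<open>A Neumann series at the level of scalars: solving for \<open>a k\<close> and iterating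
  expresses \<open>a 0\<close> through the \<open>c k\<close>. The growth of \<open>a\<close> only
  makes the remainder vanish, so \<open>D'\<close>, which will contain the uncontrolled norm of an
  inverse, does not enter the estimate.\<close>

lemma two_term_recurrence_bound:
  fixes a c :: "nat \<Rightarrow> complex" and \<alpha> \<beta> :: complex
  assumes rec: "\<And>k. c k = \<alpha> * a k + \<beta> * a (Suc k)"
    and c: "\<And>k. cmod (c k) \<le> D * real (k + 1) ^ p"
    and a: "\<And>k. cmod (a k) \<le> D' * real (k + 1) ^ p"
    and lt: "cmod \<beta> < cmod \<alpha>"
  shows "cmod (a 0) \<le> D * fact p * cmod \<alpha> ^ p / (cmod \<alpha> - cmod \<beta>) ^ (p + 1)"
proof -
  define r where "r = cmod \<beta> / cmod \<alpha>"
  have \<alpha>: "\<alpha> \<noteq> 0" "0 < cmod \<alpha>" using lt by auto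
  have r: "0 \<le> r" "r < 1" using lt \<alpha> by (auto simp: r_def)
  have "0 \<le> D" using order.trans[OF norm_ge_zero c[of 0]] by simp
  have exp: "a 0 = (\<Sum>n<m. (- \<beta> / \<alpha>) ^ n * c n / \<alpha>) + (- \<beta> / \<alpha>) ^ m * a m" for m
  proof (induction m)
    case (Suc m)
    have "a m = c m / \<alpha> + (- \<beta> / \<alpha>) * a (Suc m)"
      using rec[of m] \<alpha> by (simp add: field_simps)
    show ?case
      by (subst Suc.IH, subst \<open>a m = _\<close>) (simp add: algebra_simps)
  qed simp
  define B where "B = D / cmod \<alpha> * (fact p / (1 - r) ^ (p + 1))"
  have nr: "cmod ((- \<beta> / \<alpha>) ^ n) = r ^ n" for n
    by (simp add: r_def norm_power norm_divide)
  have bound: "cmod (a 0) \<le> B + r ^ m * (D' * real (m + 1) ^ p)" for m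
  proof -
    have "cmod (a 0) \<le> (\<Sum>n<m. cmod ((- \<beta> / \<alpha>) ^ n * c n / \<alpha>)) + cmod ((- \<beta> / \<alpha>) ^ m * a m)"
      by (subst exp[of m]) (intro order.trans[OF norm_triangle_ineq] add_mono norm_sum order.refl)
    also have "(\<Sum>n<m. cmod ((- \<beta> / \<alpha>) ^ n * c n / \<alpha>))
        \<le> (\<Sum>n<m. r ^ n * (D * real (n + 1) ^ p) / cmod \<alpha>)"
      unfolding norm_mult norm_divide[of "_ * _"] nr
      by (intro sum_mono divide_right_mono mult_left_mono c) (use r in auto)
    also have "\<dots> = D / cmod \<alpha> * (\<Sum>n<m. real (n + 1) ^ p * r ^ n)"
      by (simp add: sum_distrib_left mult_ac)
    also have "\<dots> \<le> B"
      unfolding B_def using \<open>0 \<le> D\<close>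
      by (intro mult_left_mono sum_power_geometric_bound r) auto
    also have "cmod ((- \<beta> / \<alpha>) ^ m * a m) \<le> r ^ m * (D' * real (m + 1) ^ p)"
      unfolding norm_mult nr by (intro mult_left_mono a) (use r in auto)
    finally show ?thesis by simp
  qed
  have "(\<lambda>m. r ^ m * (D' * real (m + 1) ^ p)) \<longlonglongrightarrow> 0"
  \<comment> \<open>Here \<open>r = 0\<close> means \<beta> = 0, which does occur, at
    \<open>v = 1\<close>.\<close>
  proof (cases "r = 0")
    case True
    then show ?thesis by (intro tendsto_eventually eventually_sequentiallyI[of 1]) auto
  next
    case False
    then have "0 < r" using r by simp
    then show ?thesis using r by real_asymp
  qed
  then have "(\<lambda>m. B + r ^ m * (D' * real (m + 1) ^ p)) \<longlonglongrightarrow> B + 0"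
    by (intro tendsto_intros)
  then have "cmod (a 0) \<le> B + 0"
    by (rule LIMSEQ_le_const) (use bound in blast)
  also have "B = D * fact p * cmod \<alpha> ^ p / (cmod \<alpha> - cmod \<beta>) ^ (p + 1)"
  proof -
    have "(1 - r) ^ (p + 1) = (cmod \<alpha> - cmod \<beta>) ^ (p + 1) / cmod \<alpha> ^ (p + 1)"
      using \<alpha> by (simp add: r_def diff_divide_distrib flip: power_divide del: power_Suc)
    then show ?thesis using \<alpha> by (simp add: B_def)
  qed
  finally show ?thesis by simp
qed

text \<open>In the application \<open>e k v\<close> is \<open>l\<close> of the inverse of
  \<open>T v\<close> times \<open>(1 - u) ^ k\<close>, and \<open>c k\<close> is \<open>l\<close> of
  \<open>(1 - u) ^ k\<close>. The recurrence lowers the growth by one degree at each index, so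
  \<open>e (Suc d)\<close> decays at infinity and is 0. Keeping \<open>cmod (v - 1) ^ k\<close> on
  the left of the inductive bound avoids dividing near \<open>v = 1\<close>.\<close>

lemma recurrence_of_entire_functions_vanishes:
  fixes e :: "nat \<Rightarrow> complex \<Rightarrow> complex"
  assumes hol: "\<And>k. e k holomorphic_on UNIV"
    and rec: "\<And>k v. c k = 2 * e k v + (v - 1) * e (Suc k) v"
    and growth: "\<And>v. cmod (e 0 v) \<le> C * (2 + cmod v) ^ d"
  shows "c (Suc d) = 0"
proof -
  have "\<exists>C. \<forall>v. cmod (e k v) * cmod (v - 1) ^ k \<le> C * (2 + cmod v) ^ d" if "k \<le> Suc d" for k
    using that
  proof (induction k)
    case 0
    then show ?case using growth by auto
  next
    case (Suc k)
    then obtain C where C: "\<And>v. cmod (e k v) * cmod (v - 1) ^ k \<le> C * (2 + cmod v) ^ d" by auto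
    have "cmod (e (Suc k) v) * cmod (v - 1) ^ Suc k \<le> (cmod (c k) + 2 * C) * (2 + cmod v) ^ d" for v
    proof -
      have "cmod (v - 1) ^ k \<le> (2 + cmod v) ^ k"
        using norm_triangle_ineq4[of v 1] by (intro power_mono) auto
      also have "\<dots> \<le> (2 + cmod v) ^ d" using Suc.prems by (intro power_increasing) auto
      finally have pk: "cmod (v - 1) ^ k \<le> (2 + cmod v) ^ d" .
      have "(v - 1) * e (Suc k) v = c k - 2 * e k v" using rec[of k v] by simp
      then have "cmod (v - 1) * cmod (e (Suc k) v) = cmod (c k - 2 * e k v)" by (metis norm_mult)
      also have "\<dots> \<le> cmod (c k) + 2 * cmod (e k v)"
        using norm_triangle_ineq4[of "c k" "2 * e k v"] by (simp add: norm_mult)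
      finally have "cmod (v - 1) * cmod (e (Suc k) v) * cmod (v - 1) ^ k
          \<le> (cmod (c k) + 2 * cmod (e k v)) * cmod (v - 1) ^ k"
        by (intro mult_right_mono) auto
      also have "\<dots> = cmod (c k) * cmod (v - 1) ^ k + 2 * (cmod (e k v) * cmod (v - 1) ^ k)"
        by (simp add: algebra_simps)
      also have "\<dots> \<le> cmod (c k) * (2 + cmod v) ^ d + 2 * (C * (2 + cmod v) ^ d)"
        by (intro add_mono mult_left_mono pk C) auto
      finally show ?thesis by (simp add: algebra_simps)
    qed
    then show ?case by blast
  qed
  from this[of "Suc d"] obtain C
    where C: "\<And>v. cmod (e (Suc d) v) * cmod (v - 1) ^ Suc d \<le> C * (2 + cmod v) ^ d" by auto
  have "0 \<le> C * (2 + cmod 0) ^ d" by (rule order.trans[OF _ C]) simp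
  moreover have "0 < (2 + cmod 0) ^ d" by simp
  ultimately have "0 \<le> C" by (simp only: zero_le_mult_iff) linarith
  have "(e (Suc d) \<longlongrightarrow> 0) at_infinity"
  proof (rule Lim_null_comparison)
    show "\<forall>\<^sub>F v in at_infinity. cmod (e (Suc d) v) \<le> C * 4 ^ Suc d / cmod v"
      unfolding eventually_at_infinity
    proof (intro exI[of _ 4] allI impI)
      fix v :: complex assume v: "4 \<le> cmod v"
      have "(cmod v / 2) ^ Suc d \<le> cmod (v - 1) ^ Suc d"
        using v norm_triangle_ineq2[of v 1] by (intro power_mono) auto
      then have "cmod (e (Suc d) v) * (cmod v / 2) ^ Suc d \<le> C * (2 + cmod v) ^ d"
        by (intro order.trans[OF mult_left_mono C]) auto
      also have "\<dots> \<le> C * (2 * cmod v) ^ d" using v \<open>0 \<le> C\<close> by (intro mult_left_mono power_mono) auto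
      also have "\<dots> \<le> C * (2 * 2 ^ d * cmod v ^ d)"
        using \<open>0 \<le> C\<close> by (intro mult_left_mono) (auto simp: power_mult_distrib mult_right_mono)
      also have "\<dots> = (C * 4 ^ Suc d / cmod v) * (cmod v / 2) ^ Suc d"
        using v power_mult_distrib[of "2::real" 2 d] by (auto simp: power_divide field_simps)
      finally show "cmod (e (Suc d) v) \<le> C * 4 ^ Suc d / cmod v"
        by (rule mult_right_le_imp_le) (use v in \<open>auto intro!: mult_pos_pos zero_less_power\<close>)
    qed
    show "((\<lambda>v. C * 4 ^ Suc d / cmod v) \<longlongrightarrow> 0) at_infinity"
      by (intro tendsto_divide_0[OF tendsto_const] filterlim_at_infinity_imp_norm_at_top
        filterlim_at_top_imp_at_infinity filterlim_norm_at_top)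
  qed
  \<comment> \<open>At \<open>v = 1\<close> the recurrence loses its second term.\<close>
  then have "e (Suc d) 1 = 0" by (rule Liouville_weak_0[OF hol])
  then show ?thesis using rec[of "Suc d" 1] by simp
qed

lemma cmod_one_plus_minus:
  "(cmod (1 + v))\<^sup>2 - (cmod (1 - v))\<^sup>2 = 4 * Re v"
  unfolding cmod_power2 by (simp add: power2_eq_square algebra_simps)

text \<open>
  When \<open>Re v < 0\<close>, the zero \<open>z0\<close> of the linear factor lies in the disc, at distance at least
  \<open>2 (- Re v) / (cmod (1 - v))\<^sup>2\<close> from the circle, and it tends to \<open>\<zeta>\<close> as \<open>v\<close> tends to infinity.
  A point \<open>z\<close> is either far from \<open>z0\<close>, or so near that \<open>f\<close> is bounded below at \<open>z\<close>.
\<close>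

lemma corona_lower_bound_left:
  assumes \<zeta>: "cmod \<zeta> = 1" and "0 < \<epsilon>" and "0 < \<eta>"
    and f: "\<And>z. z \<in> ball 0 1 \<Longrightarrow> cmod (z - \<zeta>) < \<eta> \<Longrightarrow> exp (- \<epsilon> / (1 - cmod z)) \<le> cmod (f z)"
    and v: "Re v < 0" "1 \<le> cmod v" "4 / \<eta> < cmod v" "1 / \<epsilon> \<le> cmod v" and z: "z \<in> ball 0 1"
  shows "exp (- 4 * \<epsilon> * (cmod v)\<^sup>2 / - Re v)
      \<le> cmod ((1 + cnj \<zeta> * z) + v * (1 - cnj \<zeta> * z)) + cmod (f z)"
proof -
  define s where "s = - Re v"
  define \<beta> where "\<beta> = cmod (1 - v)"
  define z0 where "z0 = - \<zeta> * ((1 + v) / (1 - v))"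
  have s: "0 < s" "s \<le> cmod v" using v abs_Re_le_cmod[of v] by (auto simp: s_def)
  have v1: "1 - v \<noteq> 0" using v by auto
  have "(cmod v)\<^sup>2 \<le> \<beta>\<^sup>2" using v unfolding \<beta>_def cmod_power2 by (simp add: power2_eq_square algebra_simps)
  then have \<beta>_ge: "cmod v \<le> \<beta>" by (rule power2_le_imp_le) (simp add: \<beta>_def)
  have \<beta>_le: "\<beta> \<le> 2 * cmod v" using norm_triangle_ineq4[of 1 v] v by (simp add: \<beta>_def)
  have \<beta>: "0 < \<beta>" using v1 by (simp add: \<beta>_def)
  have nz0: "cmod z0 = cmod (1 + v) / \<beta>" using \<zeta> by (simp add: z0_def norm_mult norm_divide \<beta>_def)
  have "cmod (1 + v) \<le> \<beta>"
  proof (rule power2_le_imp_le)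
    show "(cmod (1 + v))\<^sup>2 \<le> \<beta>\<^sup>2" using cmod_one_plus_minus[of v] v unfolding \<beta>_def by linarith
  qed (simp add: \<beta>_def)
  then have "4 * s \<le> (\<beta> - cmod (1 + v)) * (2 * \<beta>)"
  proof -
    have "4 * s = (\<beta> - cmod (1 + v)) * (\<beta> + cmod (1 + v))"
      using cmod_one_plus_minus[of v] by (simp add: s_def \<beta>_def power2_eq_square algebra_simps)
    also have "\<dots> \<le> (\<beta> - cmod (1 + v)) * (2 * \<beta>)"
      using \<open>cmod (1 + v) \<le> \<beta>\<close> by (intro mult_left_mono) auto
    finally show ?thesis .
  qed
  then have gap: "s / \<beta>\<^sup>2 \<le> (1 - cmod z0) / 2"
    unfolding nz0 using \<beta> by (simp add: power2_eq_square field_simps)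
  have "cnj \<zeta> * \<zeta> = 1" using \<zeta> by (simp add: complex_norm_square[symmetric] mult.commute)
  then have "cnj \<zeta> * z0 = - ((1 + v) / (1 - v))" by (simp add: z0_def mult.assoc[symmetric])
  then have "(1 + cnj \<zeta> * z) + v * (1 - cnj \<zeta> * z) = (1 - v) * (cnj \<zeta> * (z - z0))"
    using v1 by (simp add: right_diff_distrib) (simp add: field_simps)
  then have T: "cmod ((1 + cnj \<zeta> * z) + v * (1 - cnj \<zeta> * z)) = \<beta> * cmod (z - z0)"
    using \<zeta> by (simp add: norm_mult \<beta>_def)
  have goal: "exp (- 4 * \<epsilon> * (cmod v)\<^sup>2 / s) \<le> \<beta> * cmod (z - z0) + cmod (f z)"
  proof (cases "(1 - cmod z0) / 2 \<le> cmod (z - z0)")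
    case True
    \<comment> \<open>Far from \<open>z0\<close> the linear factor suffices. As
      \<open>\<epsilon> * cmod v \<ge> 1\<close>, the left side is at most
      \<open>exp (- 2 * y) \<le> 1 / (2 * y)\<close>, and this is at most
      \<open>\<beta> * (s / \<beta>\<^sup>2)\<close>.\<close>
    define y where "y = cmod v / s"
    have y: "0 < y" using s unfolding y_def by (intro divide_pos_pos) auto
    have "1 \<le> \<epsilon> * cmod v" using v \<open>0 < \<epsilon>\<close> by (simp add: pos_divide_le_eq mult.commute)
    then have "1 * y \<le> \<epsilon> * cmod v * y" using y by (intro mult_right_mono) auto
    then have "- 4 * \<epsilon> * (cmod v)\<^sup>2 / s \<le> - (2 * y)" using y by (simp add: y_def power2_eq_square)
    then have "exp (- 4 * \<epsilon> * (cmod v)\<^sup>2 / s) \<le> exp (- (2 * y))" by simp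
    also have "\<dots> \<le> 1 / (2 * y)"
    proof -
      have "2 * y \<le> exp (2 * y)" using exp_ge_add_one_self[of "2 * y"] by linarith
      then show ?thesis unfolding exp_minus inverse_eq_divide using y by (intro divide_left_mono) auto
    qed
    also have "\<dots> = s / (2 * cmod v)" by (simp add: y_def)
    also have "\<dots> \<le> s / \<beta>" using \<beta>_le \<beta> s v by (intro divide_left_mono mult_pos_pos) auto
    also have "\<dots> = \<beta> * (s / \<beta>\<^sup>2)" using \<beta> by (simp add: power2_eq_square)
    also have "\<dots> \<le> \<beta> * cmod (z - z0)" using order.trans[OF gap True] \<beta> by (intro mult_left_mono) auto
    finally show ?thesis by (simp add: add_increasing2)
  next
    case False
    \<comment> \<open>Near \<open>z0\<close> the point \<open>z\<close> keeps half of the distance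
      of \<open>z0\<close> to the circle. With \<open>\<beta> \<le> 2 * cmod v\<close> this gives
      \<open>1 - cmod z \<ge> s / (2 * cmod v)\<^sup>2\<close>, the source of the 4 in the
      exponent.\<close>
    have "cmod z \<le> cmod (z - z0) + cmod z0" using norm_triangle_ineq[of "z - z0" z0] by simp
    then have "(1 - cmod z0) / 2 \<le> 1 - cmod z" using False by (simp add: field_simps)
    then have "s / \<beta>\<^sup>2 \<le> 1 - cmod z" by (rule order.trans[OF gap])
    moreover have "s / (2 * cmod v)\<^sup>2 \<le> s / \<beta>\<^sup>2"
    proof -
      have "v \<noteq> 0" using v by auto
      then show ?thesis using \<beta> \<beta>_le s by (intro divide_left_mono power_mono) auto
    qed
    ultimately have "s / (2 * cmod v)\<^sup>2 \<le> 1 - cmod z" by simp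
    then have "\<epsilon> / (1 - cmod z) \<le> \<epsilon> / (s / (2 * cmod v)\<^sup>2)"
      using s v z \<open>0 < \<epsilon>\<close> by (intro divide_left_mono mult_pos_pos divide_pos_pos) auto
    then have le: "- 4 * \<epsilon> * (cmod v)\<^sup>2 / s \<le> - \<epsilon> / (1 - cmod z)"
      by (simp add: power_mult_distrib mult_ac)
    \<comment> \<open>Both \<open>z0 - \<zeta>\<close> and \<open>z - z0\<close> are of size at most
      \<open>2 / \<beta>\<close>; hence the threshold \<open>4 / \<eta>\<close> for
      \<open>cmod v\<close>.\<close>
    have "z0 - \<zeta> = - (2 * \<zeta>) / (1 - v)" using v1 by (simp add: z0_def field_simps)
    then have z0\<zeta>: "cmod (z0 - \<zeta>) = 2 / \<beta>" using \<zeta> by (simp add: norm_divide norm_mult \<beta>_def)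
    have "1 - cmod z0 \<le> 2 / \<beta>" using norm_triangle_ineq3[of z0 \<zeta>] \<zeta> z0\<zeta> by simp
    moreover have "2 * cmod (z - z0) < 1 - cmod z0" using False by simp
    ultimately have "2 * cmod (z - z0) < 2 / \<beta>" by (rule less_le_trans[rotated])
    moreover have "cmod (z - z0) \<le> 2 * cmod (z - z0)" by simp
    ultimately have "cmod (z - z0) < 2 / \<beta>" by (rule le_less_trans[rotated])
    moreover have "cmod (z - \<zeta>) \<le> cmod (z - z0) + 2 / \<beta>"
      using norm_triangle_ineq[of "z - z0" "z0 - \<zeta>"] z0\<zeta> by simp
    ultimately have "cmod (z - \<zeta>) < 4 / \<beta>" by simp
    also have "\<dots> \<le> 4 / cmod v" using \<beta>_ge v \<beta> by (intro divide_left_mono mult_pos_pos) auto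
    also have "\<dots> < \<eta>"
    proof -
      have "0 < cmod v" "4 < \<eta> * cmod v"
        using v \<open>0 < \<eta>\<close> by (auto simp: pos_divide_less_eq mult.commute)
      then show ?thesis by (simp only: pos_divide_less_eq)
    qed
    finally have "exp (- \<epsilon> / (1 - cmod z)) \<le> cmod (f z)" by (rule f[OF z])
    then have "exp (- 4 * \<epsilon> * (cmod v)\<^sup>2 / s) \<le> cmod (f z)"
      using le by (meson exp_le_cancel_iff order.trans)
    then show ?thesis using \<beta> by (simp add: add_increasing)
  qed
  then show ?thesis unfolding T s_def .
qed

text \<open>
  Modulo \<open>f\<close>, the algebra element \<open>T v = 2 + (v - 1) (1 - u)\<close> is invertible for every \<open>v\<close>. In the
  coordinate \<open>v\<close> the spectral point \<open>\<zeta>\<close> is sent to infinity and the unit disc to \<open>Re v < 0\<close>: the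
  zero of \<open>T v\<close> satisfies \<open>u z = (v + 1) / (v - 1)\<close>.
\<close>

locale resolvent_functional = banach_disc_algebra +
  fixes \<zeta> :: complex and f :: "complex \<Rightarrow> complex" and l :: "(complex \<Rightarrow> complex) \<Rightarrow> complex" and K :: real
  assumes z_mem: "on_disc (\<lambda>z. z) \<in> X" and f_mem: "on_disc f \<in> X" and \<zeta>: "cmod \<zeta> = 1" and K: "0 \<le> K"
    and lin: "\<And>g h a b. g \<in> X \<Longrightarrow> h \<in> X \<Longrightarrow> l (\<lambda>z. a * g z + b * h z) = a * l g + b * l h"
    and bound: "\<And>g. g \<in> X \<Longrightarrow> cmod (l g) \<le> K * N g"
    and kills: "\<And>g. g \<in> X \<Longrightarrow> l (\<lambda>z. f z * g z) = 0"
begin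

text \<open>The coordinate rotated so that \<zeta> becomes 1.\<close>

definition u :: "complex \<Rightarrow> complex" where "u z = cnj \<zeta> * z"

definition T :: "complex \<Rightarrow> complex \<Rightarrow> complex" where "T v z = (1 + u z) + v * (1 - u z)"

text \<open>A relation and not a function, as the corona hypothesis yields some inverse modulo
  \<open>f\<close> for each estimate, and different estimates may need different inverses.\<close>

definition resolvent :: "complex \<Rightarrow> (complex \<Rightarrow> complex) \<Rightarrow> bool" where
  "resolvent v G \<longleftrightarrow> G \<in> X \<and> (\<exists>h\<in>X. \<forall>z\<in>ball 0 1. T v z * G z + f z * h z = 1)"

lemma l_scale: "g \<in> X \<Longrightarrow> l (\<lambda>z. c * g z) = c * l g"
  using lin[of g g c 0] by simp

lemma u_mult_mem:
  assumes "g \<in> X" shows "(\<lambda>z. u z * g z) \<in> X"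
proof -
  have "(\<lambda>z. u z * g z) = (\<lambda>z. cnj \<zeta> * (on_disc (\<lambda>z. z) z * g z))"
    using vanish[OF assms] by (auto simp: u_def on_disc_def)
  then show ?thesis using assms by (simp add: scale_mem mult_mem z_mem)
qed

lemma q_mult_mem:
  assumes "g \<in> X" shows "(\<lambda>z. (1 - u z) * g z) \<in> X"
  using diff_mem[OF assms u_mult_mem[OF assms]] by (simp add: algebra_simps)

lemma T_mult_mem:
  assumes "g \<in> X" shows "(\<lambda>z. T v z * g z) \<in> X"
proof -
  have "(\<lambda>z. T v z * g z) = (\<lambda>z. 2 * g z + (v - 1) * ((1 - u z) * g z))"
    by (auto simp: T_def algebra_simps)
  then show ?thesis by (simp add: lincomb_mem assms q_mult_mem)
qed

lemma u_power_mult_mem: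
  assumes "g \<in> X" shows "(\<lambda>z. u z ^ k * g z) \<in> X"
proof (induction k)
  case (Suc k)
  then show ?case using u_mult_mem[OF Suc] by (simp add: mult.assoc)
qed (simp add: assms)

lemma q_power_mult_mem:
  assumes "g \<in> X" shows "(\<lambda>z. (1 - u z) ^ k * g z) \<in> X"
proof (induction k)
  case (Suc k)
  then show ?case using q_mult_mem[OF Suc] by (simp add: mult.assoc)
qed (simp add: assms)

lemma f_mult_mem:
  assumes "g \<in> X" shows "(\<lambda>z. f z * g z) \<in> X"
proof -
  have "(\<lambda>z. f z * g z) = (\<lambda>z. on_disc f z * g z)"
    using vanish[OF assms] by (auto simp: on_disc_def)
  then show ?thesis using assms by (simp add: mult_mem f_mem)
qed

lemmas mems = mult_mem u_mult_mem q_mult_mem T_mult_mem u_power_mult_mem q_power_mult_mem f_mult_mem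
  scale_mem one_mem

lemma resolvent_identity:
  assumes "resolvent v G" and \<phi>: "\<phi> \<in> X"
  shows "l \<phi> = l (\<lambda>z. T v z * (G z * \<phi> z))"
proof -
  obtain h where G: "G \<in> X" and h: "h \<in> X" "\<And>z. z \<in> ball 0 1 \<Longrightarrow> T v z * G z + f z * h z = 1"
    using assms by (auto simp: resolvent_def)
  have "\<phi> = (\<lambda>z. 1 * (T v z * (G z * \<phi> z)) + 1 * (f z * (h z * \<phi> z)))"
  proof
    fix z
    show "\<phi> z = 1 * (T v z * (G z * \<phi> z)) + 1 * (f z * (h z * \<phi> z))"
    proof (cases "z \<in> ball 0 1")
      case True
      have "1 * (T v z * (G z * \<phi> z)) + 1 * (f z * (h z * \<phi> z)) = (T v z * G z + f z * h z) * \<phi> z"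
        by (simp add: algebra_simps)
      then show ?thesis using h(2)[OF True] by simp
    qed (use vanish[OF \<phi>] in auto)
  qed
  then have "l \<phi> = l (\<lambda>z. 1 * (T v z * (G z * \<phi> z)) + 1 * (f z * (h z * \<phi> z)))" by (rule arg_cong)
  also have "\<dots> = 1 * l (\<lambda>z. T v z * (G z * \<phi> z)) + 1 * l (\<lambda>z. f z * (h z * \<phi> z))"
    using G h \<phi> by (intro lin mems)
  also have "l (\<lambda>z. f z * (h z * \<phi> z)) = 0" using h \<phi> by (intro kills mems)
  finally show ?thesis by simp
qed

text \<open>The first resolvent identity, from \<open>T w - T v = (w - v) * (1 - u)\<close>. It
  holds only under \<open>l\<close>, since \<open>G\<close> and \<open>H\<close> are unrelated
  solutions; the case \<open>v = w\<close> gives independence of the choice.\<close>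

lemma resolvent_difference:
  assumes G: "resolvent v G" and H: "resolvent w H" and \<phi>: "\<phi> \<in> X"
  shows "l (\<lambda>z. G z * \<phi> z) - l (\<lambda>z. H z * \<phi> z) = (w - v) * l (\<lambda>z. (1 - u z) * (H z * (G z * \<phi> z)))"
proof -
  have X: "G \<in> X" "H \<in> X" using G H by (auto simp: resolvent_def)
  have "l (\<lambda>z. G z * \<phi> z) - l (\<lambda>z. H z * \<phi> z)
      = 1 * l (\<lambda>z. T w z * (H z * (G z * \<phi> z))) + (- 1) * l (\<lambda>z. T v z * (G z * (H z * \<phi> z)))"
    using resolvent_identity[OF H, of "\<lambda>z. G z * \<phi> z"] resolvent_identity[OF G, of "\<lambda>z. H z * \<phi> z"] X \<phi>
    by (simp add: mems)
  also have "\<dots> = l (\<lambda>z. 1 * (T w z * (H z * (G z * \<phi> z))) + (- 1) * (T v z * (G z * (H z * \<phi> z))))"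
    using X \<phi> by (intro lin[symmetric] mems)
  also have "(\<lambda>z. 1 * (T w z * (H z * (G z * \<phi> z))) + (- 1) * (T v z * (G z * (H z * \<phi> z))))
      = (\<lambda>z. (w - v) * ((1 - u z) * (H z * (G z * \<phi> z))))"
    by (auto simp: T_def algebra_simps)
  also have "l \<dots> = (w - v) * l (\<lambda>z. (1 - u z) * (H z * (G z * \<phi> z)))"
    using X \<phi> by (intro l_scale mems)
  finally show ?thesis .
qed

lemma resolvent_unique:
  assumes "resolvent v G" "resolvent v H" "\<phi> \<in> X"
  shows "l (\<lambda>z. G z * \<phi> z) = l (\<lambda>z. H z * \<phi> z)"
  using resolvent_difference[OF assms] by simp

lemma times_one: "g \<in> X \<Longrightarrow> (\<lambda>z. g z * on_disc (\<lambda>_. 1) z) = g"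
  using vanish by (auto simp: on_disc_def)

text \<open>Lets the inverse with the best norm bound control the value of \<open>l\<close> at any
  other one.\<close>

lemma l_resolvent_le:
  assumes "resolvent v G" "resolvent v H"
  shows "cmod (l G) \<le> K * N H"
proof -
  have X: "G \<in> X" "H \<in> X" using assms by (auto simp: resolvent_def)
  have "l G = l H" using resolvent_unique[OF assms one_mem] X by (simp add: times_one)
  then show ?thesis using bound[OF X(2)] by simp
qed

lemma cmod_u: "cmod (u z) = cmod z"
  using \<zeta> by (simp add: u_def Real_Vector_Spaces.norm_mult)

lemma cmod_T_le:
  assumes "z \<in> ball 0 1"
  shows "cmod (T v z) \<le> 2 + 2 * cmod v"
proof -
  have "cmod (1 + u z) \<le> 2" "cmod (1 - u z) \<le> 2"
    using norm_triangle_ineq[of 1 "u z"] norm_triangle_ineq4[of 1 "u z"] assms by (auto simp: cmod_u)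
  then have "cmod (1 + u z) + cmod v * cmod (1 - u z) \<le> 2 + cmod v * 2"
    by (intro add_mono mult_left_mono) auto
  then show ?thesis using norm_triangle_ineq[of "1 + u z" "v * (1 - u z)"]
    by (simp add: T_def Real_Vector_Spaces.norm_mult)
qed

lemma cmod_T_diff:
  assumes "z \<in> ball 0 1"
  shows "cmod (T v z - T w z) \<le> 2 * cmod (v - w)"
proof -
  have "cmod (1 - u z) \<le> 2"
    using norm_triangle_ineq4[of 1 "u z"] assms by (auto simp: cmod_u)
  moreover have "T v z - T w z = (v - w) * (1 - u z)" by (simp add: T_def algebra_simps)
  ultimately show ?thesis by (simp add: Real_Vector_Spaces.norm_mult mult_left_mono mult.commute[of 2])
qed

end

section \<open>Existence, holomorphy and growth of the resolvent\<close>

locale corona_resolvent_functional = resolvent_functional +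
  fixes C a F C' :: real and p :: nat
  assumes C: "0 < C" and a: "1 \<le> a"
    and corona: "\<And>\<delta> f1 f2. 0 < \<delta> \<Longrightarrow> f1 \<in> X \<Longrightarrow> f2 \<in> X \<Longrightarrow>
        (\<And>z. z \<in> ball 0 1 \<Longrightarrow> \<delta> \<le> cmod (f1 z) + cmod (f2 z) \<and> cmod (f1 z) + cmod (f2 z) \<le> 1) \<Longrightarrow>
        \<exists>g1\<in>X. \<exists>g2\<in>X. (\<forall>z\<in>ball 0 1. f1 z * g1 z + f2 z * g2 z = 1) \<and> N g1 \<le> C / \<delta> powr a"
    and F: "0 \<le> F" "\<And>z. z \<in> ball 0 1 \<Longrightarrow> cmod (f z) \<le> F"
    and f_cont: "continuous_on (cball 0 1) f"
    and f_nonzero: "\<And>z. z \<in> cball 0 1 \<Longrightarrow> z \<noteq> \<zeta> \<Longrightarrow> f z \<noteq> 0"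
    and powers: "0 < C'" "\<And>n. 1 \<le> n \<Longrightarrow> N (on_disc (\<lambda>z. z ^ n)) \<le> C' * real n ^ p"
    and f_lower: "\<And>\<epsilon>. 0 < \<epsilon> \<Longrightarrow> \<exists>\<eta>>0. \<forall>z\<in>ball 0 1. cmod (z - \<zeta>) < \<eta> \<longrightarrow> exp (- \<epsilon> / (1 - cmod z)) \<le> cmod (f z)"
begin

lemma resolvent_with_bound:
  assumes \<delta>: "0 < \<delta>" and low: "\<And>z. z \<in> ball 0 1 \<Longrightarrow> \<delta> \<le> cmod (T v z) + cmod (f z)"
  obtains G where "resolvent v G" "N G \<le> C * ((2 + 2 * cmod v + F) / \<delta>) powr a"
proof -
  \<comment> \<open>An upper bound for \<open>cmod (T v z) + cmod (f z)\<close>. Dividing by it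
    meets the normalisation in the corona hypothesis.\<close>
  define L where "L = 2 + 2 * cmod v + F"
  have L: "1 \<le> L" using F(1) by (simp add: L_def)
  define f1 where "f1 = (\<lambda>z. of_real (1 / L) * (T v z * on_disc (\<lambda>_. 1) z))"
  define f2 where "f2 = (\<lambda>z. of_real (1 / L) * on_disc f z)"
  have X: "f1 \<in> X" "f2 \<in> X" unfolding f1_def f2_def by (intro mems f_mem)+
  have nf: "cmod (f1 z) + cmod (f2 z) = (cmod (T v z) + cmod (f z)) / L" if "z \<in> ball 0 1" for z
    using that L by (simp add: f1_def f2_def on_disc_def Real_Vector_Spaces.norm_mult norm_divide add_divide_distrib)
  have "\<exists>g1\<in>X. \<exists>g2\<in>X. (\<forall>z\<in>ball 0 1. f1 z * g1 z + f2 z * g2 z = 1) \<and> N g1 \<le> C / (\<delta> / L) powr a"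
  proof (rule corona[OF _ X])
    show "0 < \<delta> / L" using \<delta> L by simp
    fix z :: complex assume z: "z \<in> ball 0 1"
    show "\<delta> / L \<le> cmod (f1 z) + cmod (f2 z) \<and> cmod (f1 z) + cmod (f2 z) \<le> 1"
      unfolding nf[OF z] using low[OF z] L cmod_T_le[OF z, of v] F(2)[OF z]
      by (auto simp: L_def divide_right_mono)
  qed
  then obtain g1 g2 where g: "g1 \<in> X" "g2 \<in> X" "\<And>z. z \<in> ball 0 1 \<Longrightarrow> f1 z * g1 z + f2 z * g2 z = 1"
    "N g1 \<le> C / (\<delta> / L) powr a" by blast
  define G where "G = (\<lambda>z. of_real (1 / L) * g1 z)"
  show thesis
  proof (rule that)
    show "resolvent v G" unfolding resolvent_def
    proof (intro conjI bexI ballI)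
      show "G \<in> X" unfolding G_def by (intro mems g)
      show "(\<lambda>z. of_real (1 / L) * g2 z) \<in> X" by (intro mems g)
      show "T v z * G z + f z * (of_real (1 / L) * g2 z) = 1" if "z \<in> ball 0 1" for z
        using g(3)[OF that] that by (simp add: G_def f1_def f2_def on_disc_def mult_ac)
    qed
    have "N G = 1 / L * N g1" unfolding G_def norm_scale[OF g(1)] using L by (simp add: norm_divide)
    also have "\<dots> \<le> 1 * N g1" using L norm_nonneg[OF g(1)] by (intro mult_right_mono) auto
    also have "\<dots> \<le> C / (\<delta> / L) powr a" using g(4) by simp
    also have "\<dots> = C * (L / \<delta>) powr a" using \<delta> L by (simp add: powr_divide)
    finally show "N G \<le> C * ((2 + 2 * cmod v + F) / \<delta>) powr a" by (simp add: L_def)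
  qed
qed

text \<open>At \<zeta> the factor \<open>T v\<close> equals 2 whatever \<open>v\<close> is, and
  elsewhere on the closed disc \<open>f\<close> does not vanish; compactness does the rest.\<close>

lemma positive_lower_bound:
  obtains \<delta> where "0 < \<delta>" "\<And>z. z \<in> ball 0 1 \<Longrightarrow> \<delta> \<le> cmod (T v z) + cmod (f z)"
proof -
  have "continuous_on (cball 0 1) (\<lambda>z. cmod (T v z) + cmod (f z))"
    unfolding T_def u_def by (intro continuous_intros f_cont)
  then have "\<exists>z0\<in>cball 0 1. \<forall>z\<in>cball 0 1. cmod (T v z0) + cmod (f z0) \<le> cmod (T v z) + cmod (f z)"
    by (intro continuous_attains_inf compact_cball) auto
  then obtain z0 where z0: "z0 \<in> cball 0 1"
    "\<And>z. z \<in> cball 0 1 \<Longrightarrow> cmod (T v z0) + cmod (f z0) \<le> cmod (T v z) + cmod (f z)"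
    by blast
  show thesis
  proof (rule that)
    show "0 < cmod (T v z0) + cmod (f z0)"
    proof (cases "z0 = \<zeta>")
      case True
      then have "u z0 = 1" using \<zeta> by (simp add: u_def complex_norm_square[symmetric] mult.commute)
      then show ?thesis by (simp add: T_def add_pos_nonneg)
    next
      case False
      then show ?thesis using f_nonzero[OF z0(1)] by (simp add: add_nonneg_pos)
    qed
    show "cmod (T v z0) + cmod (f z0) \<le> cmod (T v z) + cmod (f z)" if "z \<in> ball 0 1" for z
      using that by (intro z0(2)) auto
  qed
qed

text \<open>An arbitrary choice with no regularity in \<open>v\<close>; only its values under
  \<open>l\<close> are regular.\<close>

definition R :: "complex \<Rightarrow> complex \<Rightarrow> complex" where "R v = (SOME G. resolvent v G)"

lemma resolvent_R: "resolvent v (R v)"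
proof -
  obtain \<delta> where "0 < \<delta>" "\<And>z. z \<in> ball 0 1 \<Longrightarrow> \<delta> \<le> cmod (T v z) + cmod (f z)"
    using positive_lower_bound by blast
  then obtain G where "resolvent v G" using resolvent_with_bound by blast
  then show ?thesis unfolding R_def by (rule someI[of "resolvent v"])
qed

lemma R_mem: "R v \<in> X"
  using resolvent_R by (simp add: resolvent_def)

lemma locally_bounded:
  obtains r B where "0 < r" "\<And>w \<psi>. cmod (w - v) < r \<Longrightarrow> \<psi> \<in> X \<Longrightarrow> cmod (l (\<lambda>z. R w z * \<psi> z)) \<le> B * N \<psi>"
proof -
  obtain \<delta> where \<delta>: "0 < \<delta>" "\<And>z. z \<in> ball 0 1 \<Longrightarrow> \<delta> \<le> cmod (T v z) + cmod (f z)"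
    using positive_lower_bound by blast
  \<comment> \<open>\<open>T\<close> is Lipschitz in \<open>v\<close> with constant 2, so radius
    \<open>\<delta> / 4\<close> costs half of \<delta>. The 1 keeps
    \<open>cmod w \<le> cmod v + 1\<close>.\<close>
  define r where "r = min 1 (\<delta> / 4)"
  have r: "0 < r" using \<delta> by (simp add: r_def)
  define B where "B = K * (C * ((2 + 2 * (cmod v + 1) + F) / (\<delta> / 2)) powr a)"
  show thesis
  proof (rule that[OF r])
    fix w \<psi> assume w: "cmod (w - v) < r" and \<psi>: "\<psi> \<in> X"
    have "\<delta> / 2 \<le> cmod (T w z) + cmod (f z)" if z: "z \<in> ball 0 1" for z
    proof -
      have "cmod (T v z) \<le> cmod (T w z) + cmod (T v z - T w z)" by (rule norm_triangle_sub)
      also have "cmod (T v z - T w z) \<le> 2 * cmod (w - v)"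
        using cmod_T_diff[OF z, of v w] by (simp add: norm_minus_commute)
      finally show ?thesis using w \<delta>(2)[OF z] by (simp add: r_def)
    qed
    then obtain G where G: "resolvent w G" "N G \<le> C * ((2 + 2 * cmod w + F) / (\<delta> / 2)) powr a"
      using resolvent_with_bound[of "\<delta> / 2" w] \<delta> by auto
    have GX: "G \<in> X" using G by (simp add: resolvent_def)
    have "cmod w \<le> cmod v + 1" using w norm_triangle_sub[of w v] by (simp add: r_def)
    then have "((2 + 2 * cmod w + F) / (\<delta> / 2)) powr a \<le> ((2 + 2 * (cmod v + 1) + F) / (\<delta> / 2)) powr a"
      using F(1) a \<delta> by (intro powr_mono2 divide_right_mono divide_nonneg_pos) auto
    then have "N G \<le> C * ((2 + 2 * (cmod v + 1) + F) / (\<delta> / 2)) powr a"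
      using G(2) C by (meson mult_left_mono less_imp_le order.trans)
    then have KN: "K * N G \<le> B" unfolding B_def using K by (rule mult_left_mono)
    have "cmod (l (\<lambda>z. R w z * \<psi> z)) = cmod (l (\<lambda>z. G z * \<psi> z))"
      using resolvent_unique[OF resolvent_R G(1) \<psi>] by simp
    also have "\<dots> \<le> K * N (\<lambda>z. G z * \<psi> z)" by (intro bound mems GX \<psi>)
    also have "\<dots> \<le> K * (N G * N \<psi>)" by (intro mult_left_mono norm_mult GX \<psi> K)
    also have "\<dots> \<le> B * N \<psi>"
      using mult_right_mono[OF KN norm_nonneg[OF \<psi>]] by (simp add: mult.assoc)
    finally show "cmod (l (\<lambda>z. R w z * \<psi> z)) \<le> B * N \<psi>" .
  qed
qed

text \<open>The resolvent identity is used twice: once for the difference quotient, and once more to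
  show that it converges at a linear rate. Local boundedness controls the second remainder.\<close>

lemma holomorphic_resolvent:
  assumes \<phi>: "\<phi> \<in> X"
  shows "(\<lambda>v. l (\<lambda>z. R v z * \<phi> z)) holomorphic_on UNIV"
proof -
  define e where "e = (\<lambda>v. l (\<lambda>z. R v z * \<phi> z))"
  have "\<exists>D. (e has_field_derivative D) (at v)" for v
  proof -
    obtain r B where r: "0 < r"
      and B: "\<And>w \<psi>. cmod (w - v) < r \<Longrightarrow> \<psi> \<in> X \<Longrightarrow> cmod (l (\<lambda>z. R w z * \<psi> z)) \<le> B * N \<psi>"
      using locally_bounded by blast
    define \<psi> where "\<psi> = (\<lambda>z. (1 - u z) * (R v z * \<phi> z))"
    define \<psi>' where "\<psi>' = (\<lambda>z. (1 - u z) * (R v z * \<psi> z))"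
    have mem: "\<psi> \<in> X" "\<psi>' \<in> X" unfolding \<psi>'_def \<psi>_def by (intro mems R_mem \<phi>)+
    have d1: "e w - e v = (v - w) * l (\<lambda>z. R w z * \<psi> z)" for w
    proof -
      have "(\<lambda>z. (1 - u z) * (R v z * (R w z * \<phi> z))) = (\<lambda>z. R w z * \<psi> z)"
        by (auto simp: \<psi>_def)
      then show ?thesis using resolvent_difference[OF resolvent_R resolvent_R \<phi>, of w v] by (simp add: e_def)
    qed
    have d2: "l (\<lambda>z. R w z * \<psi> z) - l (\<lambda>z. R v z * \<psi> z) = (v - w) * l (\<lambda>z. R w z * \<psi>' z)" for w
    proof -
      have "(\<lambda>z. (1 - u z) * (R v z * (R w z * \<psi> z))) = (\<lambda>z. R w z * \<psi>' z)"
        by (auto simp: \<psi>'_def)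
      then show ?thesis using resolvent_difference[OF resolvent_R resolvent_R mem(1), of w v] by simp
    qed
    define D where "D = - l (\<lambda>z. R v z * \<psi> z)"
    have "((\<lambda>w. (e w - e v) / (w - v) - D) \<longlongrightarrow> 0) (at v)"
    proof (rule Lim_null_comparison)
      show "\<forall>\<^sub>F w in at v. cmod ((e w - e v) / (w - v) - D) \<le> cmod (w - v) * (B * N \<psi>')"
        unfolding eventually_at
      proof (intro exI[of _ r] conjI ballI impI r)
        fix w assume w: "w \<noteq> v \<and> dist w v < r"
        then have "(e w - e v) / (w - v) = - l (\<lambda>z. R w z * \<psi> z)"
          unfolding d1 by (simp add: field_simps)
        then have "(e w - e v) / (w - v) - D = (w - v) * l (\<lambda>z. R w z * \<psi>' z)"
          using d2[of w] by (simp add: D_def algebra_simps)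
        moreover have "cmod (l (\<lambda>z. R w z * \<psi>' z)) \<le> B * N \<psi>'"
          using w by (intro B mem) (simp add: dist_norm)
        ultimately show "cmod ((e w - e v) / (w - v) - D) \<le> cmod (w - v) * (B * N \<psi>')"
          by (simp add: Real_Vector_Spaces.norm_mult mult_left_mono)
      qed
      have "((\<lambda>w. cmod (w - v) * (B * N \<psi>')) \<longlongrightarrow> cmod (v - v) * (B * N \<psi>')) (at v)"
        by (intro tendsto_intros)
      then show "((\<lambda>w. cmod (w - v) * (B * N \<psi>')) \<longlongrightarrow> 0) (at v)" by simp
    qed
    then have "((\<lambda>w. (e w - e v) / (w - v)) \<longlongrightarrow> D) (at v)" by (rule LIM_zero_cancel)
    then show ?thesis by (auto simp: has_field_derivative_iff)
  qed
  then have "e holomorphic_on UNIV"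
    by (simp add: holomorphic_on_def field_differentiable_def)
  then show ?thesis by (simp add: e_def)
qed

text \<open>The values of \<open>l\<close> at \<open>u ^ k\<close> times the inverse satisfy a
  two-term recurrence with coefficients \<open>1 + v\<close> and \<open>1 - v\<close>. The first
  dominates when \<open>Re v > 0\<close>, and the right-hand sides grow polynomially by the bound on
  the powers of \<open>z\<close>.\<close>

lemma resolvent_bound_right:
  obtains K' where "0 \<le> K'" "\<And>v. 0 < Re v \<Longrightarrow> cmod (l (R v)) \<le> K' * ((cmod (1 + v))\<^sup>2 / Re v) ^ (p + 1)"
proof -
  \<comment> \<open>The maximum covers \<open>k = 0\<close>, as the bound on powers starts at
    1.\<close>
  define D0 where "D0 = max C' (N (on_disc (\<lambda>_. 1)))"
  have D0: "0 \<le> D0" using powers(1) by (simp add: D0_def)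
  define pw where "pw = (\<lambda>k z. u z ^ k * on_disc (\<lambda>_. 1) z)"
  have pwX: "pw k \<in> X" for k unfolding pw_def by (intro mems)
  have pwN: "N (pw k) \<le> D0 * real (k + 1) ^ p" for k
  proof (cases "k = 0")
    case True
    then show ?thesis by (simp add: pw_def D0_def)
  next
    case False
    have one: "(\<lambda>z. z ^ k * on_disc (\<lambda>_. 1) z) = on_disc (\<lambda>z. z ^ k)" by (auto simp: on_disc_def)
    have "(\<lambda>z. \<zeta> ^ k * (u z ^ k * on_disc (\<lambda>_. 1) z)) = (\<lambda>z. z ^ k * on_disc (\<lambda>_. 1) z)"
    proof
      fix z
      have "\<zeta> * cnj \<zeta> = 1" using \<zeta> by (simp add: complex_norm_square[symmetric])
      then have "(\<zeta> * u z) ^ k = z ^ k" by (simp add: u_def mult.assoc[symmetric])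
      then show "\<zeta> ^ k * (u z ^ k * on_disc (\<lambda>_. 1) z) = z ^ k * on_disc (\<lambda>_. 1) z"
        by (simp add: power_mult_distrib)
    qed
    then have "N (on_disc (\<lambda>z. z ^ k)) = N (pw k)"
      using norm_scale[OF pwX, of "\<zeta> ^ k" k] \<zeta> one by (simp add: pw_def norm_power)
    then have "N (pw k) \<le> C' * real k ^ p" using powers(2)[of k] False by simp
    also have "\<dots> \<le> D0 * real (k + 1) ^ p"
      using D0 by (intro mult_mono power_mono) (auto simp: D0_def)
    finally show ?thesis .
  qed
  define K' where "K' = K * D0 * fact p"
  show thesis
  proof (rule that)
    show "0 \<le> K'" using K D0 by (simp add: K'_def)
    fix v :: complex assume v: "0 < Re v"
    define A where "A = cmod (1 + v)"
    define B where "B = cmod (1 - v)"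
    define G where "G = R v"
    have G: "resolvent v G" "G \<in> X" using resolvent_R R_mem by (auto simp: G_def)
    have sq: "A\<^sup>2 - B\<^sup>2 = 4 * Re v" using cmod_one_plus_minus[of v] by (simp add: A_def B_def)
    have "B\<^sup>2 < A\<^sup>2" using sq v by simp
    then have BA: "B < A" by (rule power2_less_imp_less) (simp add: A_def)
    have B0: "0 \<le> B" by (simp add: B_def)
    have A1: "1 \<le> A" using complex_Re_le_cmod[of "1 + v"] v by (simp add: A_def)
    have "cmod (l (\<lambda>z. u z ^ 0 * G z)) \<le> (K * D0) * fact p * cmod (1 + v) ^ p / (cmod (1 + v) - cmod (1 - v)) ^ (p + 1)"
    proof (rule two_term_recurrence_bound)
      fix k
      have "l (pw k) = l (\<lambda>z. T v z * (G z * pw k z))" by (intro resolvent_identity G pwX)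
      also have "(\<lambda>z. T v z * (G z * pw k z)) = (\<lambda>z. (1 + v) * (u z ^ k * G z) + (1 - v) * (u z ^ Suc k * G z))"
        using vanish[OF G(2)] by (auto simp: T_def pw_def on_disc_def algebra_simps)
      also have "l \<dots> = (1 + v) * l (\<lambda>z. u z ^ k * G z) + (1 - v) * l (\<lambda>z. u z ^ Suc k * G z)"
        by (intro lin mems G)
      finally show "l (pw k) = (1 + v) * l (\<lambda>z. u z ^ k * G z) + (1 - v) * l (\<lambda>z. u z ^ Suc k * G z)" .
      have "cmod (l (pw k)) \<le> K * N (pw k)" by (intro bound pwX)
      also have "\<dots> \<le> K * (D0 * real (k + 1) ^ p)" by (intro mult_left_mono pwN K)
      finally show "cmod (l (pw k)) \<le> K * D0 * real (k + 1) ^ p" by (simp add: mult.assoc)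
      have "(\<lambda>z. u z ^ k * G z) = (\<lambda>z. pw k z * G z)"
        using vanish[OF G(2)] by (auto simp: pw_def on_disc_def)
      then have "cmod (l (\<lambda>z. u z ^ k * G z)) \<le> K * N (\<lambda>z. pw k z * G z)"
        using bound[OF mult_mem[OF pwX G(2)]] by simp
      also have "\<dots> \<le> K * (N (pw k) * N G)" by (intro mult_left_mono norm_mult pwX G K)
      also have "\<dots> \<le> K * (D0 * real (k + 1) ^ p * N G)"
        by (intro mult_left_mono mult_right_mono pwN K norm_nonneg G)
      finally show "cmod (l (\<lambda>z. u z ^ k * G z)) \<le> (K * D0 * N G) * real (k + 1) ^ p" by (simp add: mult_ac)
    next
      show "cmod (1 - v) < cmod (1 + v)" using BA by (simp add: A_def B_def)
    qed
    then have "cmod (l G) \<le> K' * (A ^ p / (A - B) ^ (p + 1))" by (simp add: K'_def A_def B_def)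
    also have "A ^ p / (A - B) ^ (p + 1) \<le> (A\<^sup>2 / Re v) ^ (p + 1)"
    proof -
      have "4 * Re v = (A - B) * (A + B)" using sq by (simp add: power2_eq_square algebra_simps)
      also have "\<dots> \<le> (A - B) * (2 * A)" using BA by (intro mult_left_mono) auto
      finally have "4 * Re v \<le> 2 * ((A - B) * A)" by simp
      then have "Re v \<le> (A - B) * A" using v by linarith
      then have "1 / (A - B) \<le> A / Re v" using BA v by (simp add: field_simps)
      then have "(1 / (A - B)) ^ (p + 1) \<le> (A / Re v) ^ (p + 1)" using BA by (intro power_mono) auto
      moreover have "A ^ p \<le> A ^ (p + 1)" using A1 by (intro power_increasing) auto
      ultimately have "A ^ p * (1 / (A - B)) ^ (p + 1) \<le> A ^ (p + 1) * (A / Re v) ^ (p + 1)"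
        using BA A1 by (intro mult_mono) auto
      then show ?thesis by (simp add: power_divide power2_eq_square power_mult_distrib mult_ac)
    qed
    finally show "cmod (l (R v)) \<le> K' * ((cmod (1 + v))\<^sup>2 / Re v) ^ (p + 1)"
      using K D0 by (simp add: G_def A_def K'_def mult_left_mono)
  qed
qed

lemma resolvent_bound_left:
  assumes "0 < \<epsilon>"
  shows "\<exists>R\<^sub>0. \<forall>v. Re v < 0 \<longrightarrow> R\<^sub>0 \<le> cmod v \<longrightarrow> cmod (l (R v)) \<le> K * C * exp (\<epsilon> * (cmod v)\<^sup>2 / - Re v)"
proof -
  \<comment> \<open>The lower bound is \<delta> = exp (-4 E) and the normalising factor is at most
    \<open>exp E\<close>, so their quotient is at most \<open>exp (5 * E)\<close>. The corona
    exponent then contributes the factor \<open>a\<close>.\<close>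
  define \<epsilon>1 where "\<epsilon>1 = \<epsilon> / (5 * a)"
  have \<epsilon>1: "0 < \<epsilon>1" using assms a by (simp add: \<epsilon>1_def)
  obtain \<eta> where \<eta>: "0 < \<eta>"
    "\<And>z. z \<in> ball 0 1 \<Longrightarrow> cmod (z - \<zeta>) < \<eta> \<Longrightarrow> exp (- \<epsilon>1 / (1 - cmod z)) \<le> cmod (f z)"
    using f_lower[OF \<epsilon>1] by blast
  have "\<forall>\<^sub>F t in at_top. 2 + 2 * t + F \<le> exp (\<epsilon>1 * t)" using \<epsilon>1 by real_asymp
  then obtain t0 where t0: "\<And>t. t0 \<le> t \<Longrightarrow> 2 + 2 * t + F \<le> exp (\<epsilon>1 * t)"
    by (auto simp: eventually_at_top_linorder)
  show ?thesis
  proof (intro exI[of _ "max (max 1 t0) (max (4 / \<eta> + 1) (1 / \<epsilon>1))"] allI impI)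
    fix v assume v: "Re v < 0" "max (max 1 t0) (max (4 / \<eta> + 1) (1 / \<epsilon>1)) \<le> cmod v"
    define s where "s = - Re v"
    define E where "E = \<epsilon>1 * (cmod v)\<^sup>2 / s"
    have s: "0 < s" "s \<le> cmod v" using v abs_Re_le_cmod[of v] by (auto simp: s_def)
    define \<delta> where "\<delta> = exp (- 4 * E)"
    have low: "\<delta> \<le> cmod (T v z) + cmod (f z)" if "z \<in> ball 0 1" for z
      using corona_lower_bound_left[OF \<zeta> \<epsilon>1 \<eta>(1) \<eta>(2), of v z] v that
      by (simp add: \<delta>_def T_def u_def E_def s_def mult.assoc)
    obtain G where G: "resolvent v G" "N G \<le> C * ((2 + 2 * cmod v + F) / \<delta>) powr a"
      using resolvent_with_bound[of \<delta> v] low by (auto simp: \<delta>_def)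
    have "cmod v \<le> (cmod v)\<^sup>2 / s" using s by (simp add: power2_eq_square pos_le_divide_eq mult_left_mono)
    then have "\<epsilon>1 * cmod v \<le> E" using \<epsilon>1 mult_left_mono[of "cmod v" "(cmod v)\<^sup>2 / s" \<epsilon>1] by (simp add: E_def)
    then have "exp (\<epsilon>1 * cmod v) \<le> exp E" by simp
    moreover have "2 + 2 * cmod v + F \<le> exp (\<epsilon>1 * cmod v)" using v by (intro t0) simp
    ultimately have "2 + 2 * cmod v + F \<le> exp E" by (rule order.trans[rotated])
    then have "(2 + 2 * cmod v + F) / \<delta> \<le> exp E / \<delta>" by (intro divide_right_mono) (auto simp: \<delta>_def)
    also have "\<dots> = exp (5 * E)" by (simp add: \<delta>_def flip: exp_diff)
    finally have "((2 + 2 * cmod v + F) / \<delta>) powr a \<le> exp (5 * E) powr a"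
      using F(1) a by (intro powr_mono2 divide_nonneg_nonneg) (auto simp: \<delta>_def)
    also have "\<dots> = exp (\<epsilon> * (cmod v)\<^sup>2 / s)" using a by (simp add: exp_powr_real E_def \<epsilon>1_def)
    finally have "N G \<le> C * exp (\<epsilon> * (cmod v)\<^sup>2 / s)" using G(2) C by (meson mult_left_mono less_imp_le order.trans)
    then have "K * N G \<le> K * (C * exp (\<epsilon> * (cmod v)\<^sup>2 / s))" using K by (rule mult_left_mono)
    then show "cmod (l (R v)) \<le> K * C * exp (\<epsilon> * (cmod v)\<^sup>2 / - Re v)"
      using l_resolvent_le[OF resolvent_R G(1)] by (simp add: s_def)
  qed
qed

text \<open>The right-hand bound has exponent \<open>p + 1\<close>, hence the growth degree is
  \<open>2 * (p + 1)\<close> and the vanishing starts one power later. This exponent involves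
  neither \<open>l\<close> nor \<open>f\<close>.\<close>

theorem functional_vanishes:
  "l (\<lambda>z. (1 - u z) ^ Suc (2 * (p + 1)) * on_disc (\<lambda>_. 1) z) = 0"
proof -
  define pw where "pw = (\<lambda>k z. (1 - u z) ^ k * on_disc (\<lambda>_. 1) z)"
  have pwX: "pw k \<in> X" for k unfolding pw_def by (intro mems)
  define e where "e = (\<lambda>k v. l (\<lambda>z. R v z * pw k z))"
  have e_pw: "(\<lambda>z. R v z * pw k z) = (\<lambda>z. (1 - u z) ^ k * R v z)" for k v
    using vanish[OF R_mem] by (auto simp: pw_def on_disc_def)
  obtain K' where K': "0 \<le> K'" "\<And>v. 0 < Re v \<Longrightarrow> cmod (l (R v)) \<le> K' * ((cmod (1 + v))\<^sup>2 / Re v) ^ (p + 1)"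
    using resolvent_bound_right by blast
  define K'' where "K'' = max K' (K * C)"
  have e0: "e 0 v = l (R v)" for v by (simp add: e_def e_pw)
  have hol: "e k holomorphic_on UNIV" for k
    unfolding e_def by (intro holomorphic_resolvent pwX)
  have "\<exists>C. \<forall>v. cmod (e 0 v) \<le> C * (2 + cmod v) ^ (2 * (p + 1))"
  proof (rule phragmen_lindelof_polynomial_growth[OF hol])
    show "0 \<le> K''" using K' by (simp add: K''_def)
    show "cmod (e 0 v) \<le> K'' * ((cmod (1 + v))\<^sup>2 / Re v) ^ (p + 1)" if "0 < Re v" for v
      unfolding e0 K''_def using that
      by (intro order.trans[OF K'(2)] mult_right_mono) auto
    show "\<exists>R\<^sub>0. \<forall>v. Re v < 0 \<longrightarrow> R\<^sub>0 \<le> cmod v \<longrightarrow> cmod (e 0 v) \<le> K'' * exp (\<epsilon> * (cmod v)\<^sup>2 / - Re v)"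
      if "0 < \<epsilon>" for \<epsilon>
      using resolvent_bound_left[OF that] unfolding e0 K''_def
      by (meson exp_ge_zero max.cobounded2 mult_right_mono order.trans)
  qed simp
  then obtain M where M: "\<And>v. cmod (e 0 v) \<le> M * (2 + cmod v) ^ (2 * (p + 1))" by blast
  have "l (pw (Suc (2 * (p + 1)))) = 0"
  proof (rule recurrence_of_entire_functions_vanishes[where e = e and c = "\<lambda>k. l (pw k)" and C = M])
    fix k v
    have "l (pw k) = l (\<lambda>z. T v z * (R v z * pw k z))" by (intro resolvent_identity resolvent_R pwX)
    also have "(\<lambda>z. T v z * (R v z * pw k z)) = (\<lambda>z. 2 * (R v z * pw k z) + (v - 1) * (R v z * pw (Suc k) z))"
      by (auto simp: T_def pw_def algebra_simps)
    also have "l \<dots> = 2 * e k v + (v - 1) * e (Suc k) v"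
      unfolding e_def by (intro lin mems R_mem pwX)
    finally show "l (pw k) = 2 * e k v + (v - 1) * e (Suc k) v" .
  qed (fact hol M)+
  then show ?thesis by (simp only: pw_def)
qed

end

subsection \<open>Cyclicity\<close>

theorem theorem3:
  fixes X \<A> :: "(complex \<Rightarrow> complex) set"
    and normX normA :: "(complex \<Rightarrow> complex) \<Rightarrow> real"
    and \<zeta>\<^sub>0 :: complex
    and f :: "complex \<Rightarrow> complex"
  assumes X_banach: "banach_disc_space X normX"
    and X_analytic: "\<And>h. h \<in> X \<Longrightarrow> h holomorphic_on ball 0 1"
    and X_eval: "continuous_evaluations X normX"
    and X_shift: "\<And>h. h \<in> X \<Longrightarrow> (\<lambda>z. z * h z) \<in> X"
    and X_polynomials: "polynomials \<subseteq> X"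
    and X_polynomials_dense: "norm_topology X normX closure_of polynomials = X"
    and A_banach: "banach_disc_algebra \<A> normA"
    and A_multipliers: "\<A> \<subseteq> multipliers X"
    and A_eval: "continuous_evaluations \<A> normA"
    and A_corona: "\<exists>C>0. \<exists>a\<ge>1. \<forall>\<delta>>0. \<forall>f1\<in>\<A>. \<forall>f2\<in>\<A>.
        (\<forall>z\<in>ball 0 1. \<delta> \<le> cmod (f1 z) + cmod (f2 z) \<and> cmod (f1 z) + cmod (f2 z) \<le> 1) \<longrightarrow>
        (\<exists>g1\<in>\<A>. \<exists>g2\<in>\<A>. (\<forall>z\<in>ball 0 1. f1 z * g1 z + f2 z * g2 z = 1) \<and>
            normA g1 \<le> C / \<delta> powr a \<and> normA g2 \<le> C / \<delta> powr a)"
    and A_z: "on_disc (\<lambda>z. z) \<in> \<A>"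
    and A_powers: "\<exists>C'>0. \<exists>p::nat. \<forall>n\<ge>1. normA (on_disc (\<lambda>z. z ^ n)) \<le> C' * real n ^ p"
    and \<zeta>\<^sub>0: "\<zeta>\<^sub>0 \<in> sphere 0 1"
    and \<zeta>\<^sub>0_cyclic: "cyclic X normX (on_disc (\<lambda>z. z - \<zeta>\<^sub>0))"
    and f_A: "on_disc f \<in> \<A>"
    and f_disc_algebra: "f \<in> disc_algebra"
    and f_outer: "outer f"
    and f_zeros: "circle_zeros f = {\<zeta>\<^sub>0}"
  shows "cyclic X normX (on_disc f)"
proof -
  interpret X: banach_disc_space X normX by (rule X_banach)
  interpret A: banach_disc_algebra \<A> normA by (rule A_banach)
  obtain C a where corona: "0 < C" "1 \<le> a" "\<forall>\<delta>>0. \<forall>f1\<in>\<A>. \<forall>f2\<in>\<A>.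
        (\<forall>z\<in>ball 0 1. \<delta> \<le> cmod (f1 z) + cmod (f2 z) \<and> cmod (f1 z) + cmod (f2 z) \<le> 1) \<longrightarrow>
        (\<exists>g1\<in>\<A>. \<exists>g2\<in>\<A>. (\<forall>z\<in>ball 0 1. f1 z * g1 z + f2 z * g2 z = 1) \<and>
            normA g1 \<le> C / \<delta> powr a \<and> normA g2 \<le> C / \<delta> powr a)"
    using A_corona by blast
  obtain C' p where powers: "0 < C'" "\<And>n. 1 \<le> n \<Longrightarrow> normA (on_disc (\<lambda>z. z ^ n)) \<le> C' * real n ^ p"
    using A_powers by blast
  have AX: "g \<in> X" if "g \<in> \<A>" for g using that A_multipliers by (auto simp: multipliers_def)
  have A_mult: "(\<lambda>z. \<phi> z * g z) \<in> X" if "\<phi> \<in> \<A>" "g \<in> X" for \<phi> g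
    using that A_multipliers by (auto simp: multipliers_def)
  have poly_mult: "(\<lambda>z. poly r z * g z) \<in> X" if "g \<in> X" for r g
  proof (induction r)
    case (pCons c r)
    have "(\<lambda>z. poly (pCons c r) z * g z) = (\<lambda>z. c * g z + z * (poly r z * g z))"
      by (auto simp: algebra_simps)
    then show ?case using pCons that by (simp add: X.add_mem X.scale_mem X_shift)
  qed (simp add: X.zero_mem)
  have poly_mult_A: "(\<lambda>z. poly r z * g z) \<in> \<A>" if g: "g \<in> \<A>" for r g
  proof (induction r)
    case (pCons c r)
    have "(\<lambda>z. poly (pCons c r) z * g z) = (\<lambda>z. c * g z + on_disc (\<lambda>z. z) z * (poly r z * g z))"
      using A.vanish[OF g] by (auto simp: algebra_simps on_disc_def)
    then show ?case using pCons g A_z by (simp add: A.add_mem A.scale_mem A.mult_mem)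
  qed (simp add: A.zero_mem)
  have poly_X: "on_disc (poly r) \<in> X" for r using X_polynomials by (auto simp: polynomials_def)
  have dense: "\<exists>r. normX (\<lambda>z. g z - on_disc (poly r) z) < \<epsilon>" if "g \<in> X" "0 < \<epsilon>" for g \<epsilon>
    using that X.in_closure_iff[OF X_polynomials, of g] X_polynomials_dense
    by (auto simp: polynomials_def)
  have one_X: "on_disc (\<lambda>_. 1) \<in> X" by (rule AX[OF A.one_mem])

  define S where "S = {(\<lambda>z. q z * on_disc f z) |q. q \<in> polynomials}"
  have S_iff: "g \<in> S \<longleftrightarrow> (\<exists>r. g = (\<lambda>z. poly r z * on_disc f z))" for g
  proof -
    have eq: "(\<lambda>z. on_disc (poly r) z * on_disc f z) = (\<lambda>z. poly r z * on_disc f z)" for r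
      by (auto simp: on_disc_def)
    have "S = range (\<lambda>r z. on_disc (poly r) z * on_disc f z)"
      unfolding S_def polynomials_def by blast
    then show ?thesis unfolding eq by blast
  qed
  have fX: "on_disc f \<in> X" by (rule AX[OF f_A])
  have SX: "S \<subseteq> X" using poly_mult[OF fX] by (auto simp: S_iff)
  have S_lin: "(\<lambda>z. b * g z + c * h z) \<in> S" if gh: "g \<in> S" "h \<in> S" for g h b c
  proof -
    obtain r s where "g = (\<lambda>z. poly r z * on_disc f z)" "h = (\<lambda>z. poly s z * on_disc f z)"
      using gh by (auto simp: S_iff)
    then have "(\<lambda>z. b * g z + c * h z) = (\<lambda>z. poly (smult b r + smult c s) z * on_disc f z)"
      by (auto simp: algebra_simps)
    then show ?thesis unfolding S_iff by blast
  qed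
  have S_zero: "(\<lambda>_. 0) \<in> S" unfolding S_iff by (rule exI[of _ 0]) simp
  define M where "M = norm_topology X normX closure_of S"
  have M_iff: "g \<in> M \<longleftrightarrow> g \<in> X \<and> (\<forall>\<epsilon>>0. \<exists>s\<in>S. normX (\<lambda>z. g z - s z) < \<epsilon>)" for g
    unfolding M_def by (rule X.in_closure_iff[OF SX])
  have M_closed: "g \<in> M" if g: "g \<in> X" and *: "\<And>\<epsilon>. 0 < \<epsilon> \<Longrightarrow> \<exists>h\<in>M. normX (\<lambda>z. g z - h z) < \<epsilon>" for g
    unfolding M_iff
  proof (intro conjI allI impI g)
    fix \<epsilon> :: real assume "0 < \<epsilon>"
    then obtain h where h: "h \<in> M" "normX (\<lambda>z. g z - h z) < \<epsilon> / 2" using *[of "\<epsilon> / 2"] by auto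
    then obtain s where s: "s \<in> S" "normX (\<lambda>z. h z - s z) < \<epsilon> / 2"
      using \<open>0 < \<epsilon>\<close> unfolding M_iff by (meson half_gt_zero)
    have "normX (\<lambda>z. g z - s z) < \<epsilon>"
      using X.norm_triangle_via[of g h s] h s g SX by (auto simp: M_iff)
    then show "\<exists>s\<in>S. normX (\<lambda>z. g z - s z) < \<epsilon>" using s by blast
  qed

  \<comment> \<open>Continuity of the inclusion of \<A> in \<open>X\<close>, needed to view
    functionals on \<open>X\<close> as bounded functionals on \<A>.\<close>
  obtain KA where KA: "0 \<le> KA" "\<And>g. g \<in> \<A> \<Longrightarrow> normX (\<lambda>z. 1 * g z) \<le> KA * normA g"
    using multiplication_operator_bounded[OF _ X_banach A_eval X_eval, of "\<lambda>_. 1"] A.banach_disc_space_axioms AX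
    by auto
  obtain Kf where Kf: "0 \<le> Kf" "\<And>g. g \<in> X \<Longrightarrow> normX (\<lambda>z. on_disc f z * g z) \<le> Kf * normX g"
    using multiplication_operator_bounded[OF X_banach X_banach X_eval X_eval, of "on_disc f"] A_mult[OF f_A]
    by blast

  have \<zeta>: "cmod \<zeta>\<^sub>0 = 1" using \<zeta>\<^sub>0 by simp
  have f_cont: "continuous_on (cball 0 1) f" using f_disc_algebra by (simp add: disc_algebra_def)
  obtain F where F: "0 \<le> F" "\<And>z. z \<in> cball 0 1 \<Longrightarrow> cmod (f z) \<le> F"
  proof -
    have "bounded (f ` cball 0 1)"
      by (intro compact_imp_bounded compact_continuous_image f_cont compact_cball)
    then show thesis using that unfolding bounded_pos by (metis imageI less_imp_le)
  qed
  have f_nonzero: "f z \<noteq> 0" if "z \<in> cball 0 1" "z \<noteq> \<zeta>\<^sub>0" for z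
  proof (cases "cmod z = 1")
    case True
    then show ?thesis using f_zeros that by (auto simp: circle_zeros_def)
  next
    case False
    then show ?thesis using outer_nonzero[OF f_outer, of z] that by simp
  qed

  define n where "n = Suc (2 * (p + 1))"
  \<comment> \<open>The polynomial factor \<open>r\<close> stays arbitrary because lowering
    \<open>k\<close> at one \<open>r\<close> uses the next exponent at another polynomial.\<close>
  define x where "x = (\<lambda>r k z. poly r z * ((z - \<zeta>\<^sub>0) ^ k * on_disc (\<lambda>_. 1) z))"
  have x_eq: "x r k = (\<lambda>z. poly (r * [:- \<zeta>\<^sub>0, 1:] ^ k) z * on_disc (\<lambda>_. 1) z)" for r k
    by (auto simp: x_def poly_power mult.assoc fun_eq_iff)
  have xX: "x r k \<in> X" for r k unfolding x_eq by (intro poly_mult one_X)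

  have top: "x r n \<in> M" for r
  proof (rule ccontr)
    assume "x r n \<notin> M"
    then obtain \<epsilon> where \<epsilon>: "0 < \<epsilon>" "\<And>s. s \<in> S \<Longrightarrow> \<epsilon> \<le> normX (\<lambda>z. x r n z - s z)"
      using xX by (force simp: M_iff not_less)
    obtain l where l_lin: "\<And>g h a b. g \<in> X \<Longrightarrow> h \<in> X \<Longrightarrow> l (\<lambda>z. a * g z + b * h z) = a * l g + b * l h"
      and l_le: "\<And>g. g \<in> X \<Longrightarrow> cmod (l g) \<le> normX g" and l_S: "\<And>s. s \<in> S \<Longrightarrow> l s = 0" and l_x: "l (x r n) \<noteq> 0"
      using X.separating_functional[OF SX S_lin S_zero xX \<epsilon>] by blast
    \<comment> \<open>Only polynomial multiples of \<open>f\<close> are killed by construction.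
      Density of the polynomials and continuity of multiplication by \<open>f\<close> on
      \<open>X\<close> extend this to all multiples.\<close>
    have l_f: "l (\<lambda>z. on_disc f z * g z) = 0" if g: "g \<in> X" for g
    proof -
      have le: "cmod (l (\<lambda>z. on_disc f z * g z)) \<le> Kf * \<epsilon>" if \<epsilon>: "0 < \<epsilon>" for \<epsilon>
      proof -
        obtain s where s: "normX (\<lambda>z. g z - on_disc (poly s) z) < \<epsilon>" using dense[OF g \<epsilon>] by blast
        have "(\<lambda>z. on_disc f z * on_disc (poly s) z) \<in> S"
          unfolding S_iff by (rule exI[of _ s]) (auto simp: on_disc_def)
        then have "l (\<lambda>z. on_disc f z * on_disc (poly s) z) = 0" by (rule l_S)
        moreover have "l (\<lambda>z. 1 * (on_disc f z * g z) + (- 1) * (on_disc f z * on_disc (poly s) z))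
            = 1 * l (\<lambda>z. on_disc f z * g z) + (- 1) * l (\<lambda>z. on_disc f z * on_disc (poly s) z)"
          by (intro l_lin A_mult f_A g poly_X)
        moreover have "(\<lambda>z. 1 * (on_disc f z * g z) + (- 1) * (on_disc f z * on_disc (poly s) z))
            = (\<lambda>z. on_disc f z * (g z - on_disc (poly s) z))" by (simp add: algebra_simps)
        ultimately have "l (\<lambda>z. on_disc f z * g z) = l (\<lambda>z. on_disc f z * (g z - on_disc (poly s) z))" by simp
        then have "cmod (l (\<lambda>z. on_disc f z * g z)) \<le> normX (\<lambda>z. on_disc f z * (g z - on_disc (poly s) z))"
          using l_le[OF A_mult[OF f_A X.diff_mem[OF g poly_X]]] by simp
        also have "\<dots> \<le> Kf * normX (\<lambda>z. g z - on_disc (poly s) z)"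
          by (intro Kf X.diff_mem g poly_X)
        also have "\<dots> \<le> Kf * \<epsilon>" using s Kf by (intro mult_left_mono) auto
        finally show ?thesis .
      qed
      have "cmod (l (\<lambda>z. on_disc f z * g z)) \<le> 0 + e" if e: "0 < e" for e
      proof -
        have "cmod (l (\<lambda>z. on_disc f z * g z)) \<le> Kf * (e / (Kf + 1))" using e Kf by (intro le) auto
        also have "\<dots> \<le> e" using e Kf by (simp add: field_simps)
        finally show ?thesis by simp
      qed
      then have "cmod (l (\<lambda>z. on_disc f z * g z)) \<le> 0" by (rule field_le_epsilon)
      then show ?thesis by simp
    qed
    \<comment> \<open>Twisting by \<open>r\<close> lets \<open>functional_vanishes\<close>, a
      statement about a single function, reach every polynomial multiple of
      \<open>(z - \<zeta>\<^sub>0) ^ n\<close>.\<close>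
    define l' where "l' = (\<lambda>g. l (\<lambda>z. poly r z * g z))"
    define Kr where "Kr = KA * normA (\<lambda>z. poly r z * on_disc (\<lambda>_. 1) z)"
    interpret corona_resolvent_functional \<A> normA \<zeta>\<^sub>0 f l' Kr C a F C' p
    proof
      show "on_disc (\<lambda>z. z) \<in> \<A>" by (rule A_z)
      show "on_disc f \<in> \<A>" by (rule f_A)
      show "cmod \<zeta>\<^sub>0 = 1" by (rule \<zeta>)
      show "0 \<le> Kr" unfolding Kr_def using KA A.norm_nonneg[OF poly_mult_A[OF A.one_mem]] by simp
      show "l' (\<lambda>z. a * g z + b * h z) = a * l' g + b * l' h" if "g \<in> \<A>" "h \<in> \<A>" for g h a b
      proof -
        have "(\<lambda>z. poly r z * (a * g z + b * h z)) = (\<lambda>z. a * (poly r z * g z) + b * (poly r z * h z))"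
          by (simp add: algebra_simps)
        then show ?thesis using that l_lin[OF poly_mult poly_mult] AX by (simp add: l'_def)
      qed
      show "cmod (l' g) \<le> Kr * normA g" if g: "g \<in> \<A>" for g
      proof -
        have eq: "(\<lambda>z. poly r z * g z) = (\<lambda>z. (poly r z * on_disc (\<lambda>_. 1) z) * g z)"
          using A.vanish[OF g] by (auto simp: on_disc_def)
        have "cmod (l' g) \<le> normX (\<lambda>z. 1 * (poly r z * g z))"
          unfolding l'_def using l_le[OF poly_mult[OF AX[OF g]]] by simp
        also have "\<dots> \<le> KA * normA (\<lambda>z. poly r z * g z)" by (intro KA poly_mult_A g)
        also have "\<dots> \<le> KA * (normA (\<lambda>z. poly r z * on_disc (\<lambda>_. 1) z) * normA g)"
          unfolding eq by (intro mult_left_mono A.norm_mult poly_mult_A A.one_mem g KA)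
        finally show ?thesis by (simp add: Kr_def mult.assoc)
      qed
      show "l' (\<lambda>z. f z * g z) = 0" if g: "g \<in> \<A>" for g
      proof -
        have "(\<lambda>z. poly r z * (f z * g z)) = (\<lambda>z. on_disc f z * (poly r z * g z))"
          using A.vanish[OF g] by (auto simp: on_disc_def)
        then show ?thesis using l_f[OF poly_mult[OF AX[OF g]]] by (simp add: l'_def)
      qed
      show "0 < C" "1 \<le> a" by (fact corona)+
      show "\<exists>g1\<in>\<A>. \<exists>g2\<in>\<A>. (\<forall>z\<in>ball 0 1. f1 z * g1 z + f2 z * g2 z = 1) \<and> normA g1 \<le> C / \<delta> powr a"
        if "0 < \<delta>" "f1 \<in> \<A>" "f2 \<in> \<A>"
          "\<And>z. z \<in> ball 0 1 \<Longrightarrow> \<delta> \<le> cmod (f1 z) + cmod (f2 z) \<and> cmod (f1 z) + cmod (f2 z) \<le> 1" for \<delta> f1 f2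
      proof -
        have "\<forall>z\<in>ball 0 1. \<delta> \<le> cmod (f1 z) + cmod (f2 z) \<and> cmod (f1 z) + cmod (f2 z) \<le> 1"
          by (rule ballI) (rule that(4))
        from corona(3)[THEN spec, THEN mp, OF that(1), THEN bspec, OF that(2), THEN bspec, OF that(3), THEN mp, OF this]
        show ?thesis by (elim bexE conjE) (intro bexI conjI, assumption+)
      qed
      show "0 \<le> F" by (rule F)
      show "cmod (f z) \<le> F" if "z \<in> ball 0 1" for z using that by (intro F) auto
      show "continuous_on (cball 0 1) f" by (rule f_cont)
      show "f z \<noteq> 0" if "z \<in> cball 0 1" "z \<noteq> \<zeta>\<^sub>0" for z using that by (rule f_nonzero)
      show "0 < C'" by (rule powers)
      show "normA (on_disc (\<lambda>z. z ^ n)) \<le> C' * real n ^ p" if "1 \<le> n" for n using that by (rule powers)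
      show "\<exists>\<eta>>0. \<forall>z\<in>ball 0 1. cmod (z - \<zeta>\<^sub>0) < \<eta> \<longrightarrow> exp (- \<epsilon> / (1 - cmod z)) \<le> cmod (f z)"
        if "0 < \<epsilon>" for \<epsilon> using f_outer that \<zeta>\<^sub>0 by (rule outer_lower_bound)
    qed
    have "l' (\<lambda>z. (1 - u z) ^ n * on_disc (\<lambda>_. 1) z) = 0"
      unfolding n_def by (rule functional_vanishes)
    moreover have "(\<lambda>z. poly r z * ((1 - u z) ^ n * on_disc (\<lambda>_. 1) z)) = (\<lambda>z. (- cnj \<zeta>\<^sub>0) ^ n * x r n z + 0 * x r n z)"
    proof
      fix z
      have "cnj \<zeta>\<^sub>0 * \<zeta>\<^sub>0 = 1" using \<zeta> by (simp add: complex_norm_square[symmetric] mult.commute)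
      then have "1 - u z = - cnj \<zeta>\<^sub>0 * (z - \<zeta>\<^sub>0)" by (simp add: u_def algebra_simps)
      then show "poly r z * ((1 - u z) ^ n * on_disc (\<lambda>_. 1) z) = (- cnj \<zeta>\<^sub>0) ^ n * x r n z + 0 * x r n z"
        by (simp only: x_def power_mult_distrib) (simp add: mult_ac)
    qed
    ultimately have "(- cnj \<zeta>\<^sub>0) ^ n * l (x r n) = 0"
      using l_lin[OF xX xX, of "(- cnj \<zeta>\<^sub>0) ^ n" r n 0 r n] by (simp add: l'_def)
    then show False using l_x \<zeta> by auto
  qed

  \<comment> \<open>Cyclicity approximates \<open>r\<close> by some
    \<open>s * (z - \<zeta>\<^sub>0)\<close>. Multiplication by
    \<open>(z - \<zeta>\<^sub>0) ^ k\<close> is continuous on \<open>X\<close> and carries this to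
    an approximation of \<open>x r k\<close> by \<open>x s (Suc k)\<close>.\<close>
  have step: "x r k \<in> M" if up: "\<And>r. x r (Suc k) \<in> M" for r k
  proof (rule M_closed[OF xX])
    fix \<epsilon> :: real assume \<epsilon>: "0 < \<epsilon>"
    have maps: "(\<lambda>z. (z - \<zeta>\<^sub>0) ^ k * g z) \<in> X" if "g \<in> X" for g
      using poly_mult[OF that, of "[:- \<zeta>\<^sub>0, 1:] ^ k"] by (simp add: poly_power)
    obtain Kk where Kk: "0 \<le> Kk" "\<And>g. g \<in> X \<Longrightarrow> normX (\<lambda>z. (z - \<zeta>\<^sub>0) ^ k * g z) \<le> Kk * normX g"
      using multiplication_operator_bounded[OF X_banach X_banach X_eval X_eval, of "\<lambda>z. (z - \<zeta>\<^sub>0) ^ k"] maps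
      by blast
    have sub: "{(\<lambda>z. q z * on_disc (\<lambda>z. z - \<zeta>\<^sub>0) z) |q. q \<in> polynomials} \<subseteq> X"
    proof -
      have "(\<lambda>z. on_disc (poly s) z * on_disc (\<lambda>z. z - \<zeta>\<^sub>0) z) = on_disc (poly (s * [:- \<zeta>\<^sub>0, 1:]))" for s
        by (auto simp: on_disc_def fun_eq_iff algebra_simps)
      then show ?thesis using poly_X by (auto simp: polynomials_def)
    qed
    have "on_disc (poly r) \<in> norm_topology X normX closure_of {(\<lambda>z. q z * on_disc (\<lambda>z. z - \<zeta>\<^sub>0) z) |q. q \<in> polynomials}"
      using \<zeta>\<^sub>0_cyclic poly_X by (simp add: cyclic_def)
    then have "\<exists>t\<in>{(\<lambda>z. q z * on_disc (\<lambda>z. z - \<zeta>\<^sub>0) z) |q. q \<in> polynomials}.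
        normX (\<lambda>z. on_disc (poly r) z - t z) < \<epsilon> / (Kk + 1)"
      unfolding X.in_closure_iff[OF sub] using \<epsilon> Kk(1) by auto
    then obtain s where s: "normX (\<lambda>z. on_disc (poly r) z - on_disc (poly s) z * on_disc (\<lambda>z. z - \<zeta>\<^sub>0) z) < \<epsilon> / (Kk + 1)"
      by (auto simp: polynomials_def)
    define d where "d = (\<lambda>z. on_disc (poly r) z - on_disc (poly s) z * on_disc (\<lambda>z. z - \<zeta>\<^sub>0) z)"
    have d_eq: "d = (\<lambda>z. poly (r - s * [:- \<zeta>\<^sub>0, 1:]) z * on_disc (\<lambda>_. 1) z)"
      by (auto simp: d_def on_disc_def fun_eq_iff algebra_simps)
    have dX: "d \<in> X" unfolding d_eq by (intro poly_mult one_X)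
    have "(\<lambda>z. x r k z - x s (Suc k) z) = (\<lambda>z. (z - \<zeta>\<^sub>0) ^ k * d z)"
      by (auto simp: x_def d_def on_disc_def fun_eq_iff algebra_simps)
    then have "normX (\<lambda>z. x r k z - x s (Suc k) z) \<le> Kk * normX d" using Kk(2)[OF dX] by simp
    also have "\<dots> \<le> Kk * (\<epsilon> / (Kk + 1))" using s Kk by (intro mult_left_mono) (auto simp: d_def)
    also have "\<dots> < \<epsilon>" using \<epsilon> Kk by (simp add: field_simps)
    finally show "\<exists>h\<in>M. normX (\<lambda>z. x r k z - h z) < \<epsilon>" using up by blast
  qed
  have "x r (n - k) \<in> M" if "k \<le> n" for r k
    using that
  proof (induction k arbitrary: r)
    case 0
    then show ?case using top by simp
  next
    case (Suc k)
    then have eq: "Suc (n - Suc k) = n - k" by simp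
    show ?case
    proof (rule step)
      show "x s (Suc (n - Suc k)) \<in> M" for s unfolding eq using Suc by simp
    qed
  qed
  from this[of n] have x0: "x r 0 \<in> M" for r by simp
  have "M = X"
  proof
    show "M \<subseteq> X" by (auto simp: M_iff)
    show "X \<subseteq> M"
    proof
      fix g assume g: "g \<in> X"
      show "g \<in> M"
      proof (rule M_closed[OF g])
        fix \<epsilon> :: real assume "0 < \<epsilon>"
        then obtain r where "normX (\<lambda>z. g z - on_disc (poly r) z) < \<epsilon>" using dense[OF g] by blast
        moreover have "on_disc (poly r) = x r 0" by (auto simp: x_def on_disc_def)
        ultimately show "\<exists>h\<in>M. normX (\<lambda>z. g z - h z) < \<epsilon>" using x0[of r] by auto
      qed
    qed
  qed
  then show ?thesis using fX by (simp add: cyclic_def M_def S_def)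
qed

end
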